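(* Let $\mathcal{Z}=\{z_{n,j}\}$ be a separated triangular family of points in $\mathbb{T}$. Then $\mathcal{Z}$ is an M-Z family for $L^\infty$ if and only if $$D^-(\mathcal{Z})=\liminf_{R\to\infty}\left(\liminf_{n\to\infty}\frac{\min_{x\in[0,2\pi]}\#\big(\mathcal{Z}(n)\cap(x,x+R/n)\big)}{R}\right)>\frac1{2\pi}.$$
   Context: $\mathbb{T}$ is the unit circle in $\mathbb{C}$. $\mathcal{P}_n$ is the space of holomorphic polynomials (complex coefficients, one variable) of degree at most $n$. A triangular family is a collection $\mathcal{Z}=\{z_{n,j}\}$, $n\ge 0$, $0\le j\le m_n$, of points $z_{n,j}\in\mathbb{T}$; its $n$-th generation is $\mathcal{Z}(n)=\{z_{n,0},\dots,z_{n,m_n}\}$. It is assumed that $m_n\ge n$ for all $n$. $\mathcal{Z}$ is an M-Z (Marcinkiewicz-Zygmund) family for $L^\infty$ if there is a constant $C>0$ such that for all $n\ge 1$ and all $q\in\mathcal{P}_n$, $\sup_{|z|=1}|q(z)|\le C\sup_{0\le j\le m_n}|q(z_{n,j})|$. $\mathcal{Z}$ is separated if there is $\varepsilon>0$ such that $|z_{n,j}-z_{n,k}|\ge\varepsilon/n$ for all $n\ge1$ and all $0\le j,k\le m_n$ with $j\ne k$. For real $x<y$, $(x,y)$ denotes the arc of $\mathbb{T}$ delimited by the endpoints $e^{ix}$ and $e^{iy}$, i.e. $\{e^{i\theta}:x<\theta<y\}$. *)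

theory Defs
  imports "HOL-Analysis.Analysis" "HOL-Computational_Algebra.Polynomial"
begin

text \<open>A family is given by the row lengths \<open>m\<close> and the points \<open>z n j\<close>, of which only those
  with \<open>j \<le> m n\<close> are relevant.\<close>

definition triangular_family :: "(nat \<Rightarrow> nat) \<Rightarrow> (nat \<Rightarrow> nat \<Rightarrow> complex) \<Rightarrow> bool" where
  "triangular_family m z \<longleftrightarrow> (\<forall>n. n \<le> m n \<and> (\<forall>j\<le>m n. z n j \<in> sphere 0 1))"

definition generation :: "(nat \<Rightarrow> nat) \<Rightarrow> (nat \<Rightarrow> nat \<Rightarrow> complex) \<Rightarrow> nat \<Rightarrow> complex set" where
  "generation m z n = z n ` {..m n}"

definition MZ_family_Linf :: "(nat \<Rightarrow> nat) \<Rightarrow> (nat \<Rightarrow> nat \<Rightarrow> complex) \<Rightarrow> bool" where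
  "MZ_family_Linf m z \<longleftrightarrow>
     (\<exists>C>0::real. \<forall>n\<ge>1. \<forall>q :: complex poly. degree q \<le> n \<longrightarrow>
        (SUP w\<in>sphere 0 1. norm (poly q w)) \<le> C * (SUP j\<in>{..m n}. norm (poly q (z n j))))"

definition separated_family :: "(nat \<Rightarrow> nat) \<Rightarrow> (nat \<Rightarrow> nat \<Rightarrow> complex) \<Rightarrow> bool" where
  "separated_family m z \<longleftrightarrow>
     (\<exists>\<epsilon>>0::real. \<forall>n\<ge>1. \<forall>j\<le>m n. \<forall>k\<le>m n. j \<noteq> k \<longrightarrow> norm (z n j - z n k) \<ge> \<epsilon> / real n)"

definition arc_between :: "real \<Rightarrow> real \<Rightarrow> complex set" where
  "arc_between x y = cis ` {x<..<y}"

text \<open>The minimum below is over a finite nonempty set of naturals, the counts being bounded by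
  \<open>m n + 1\<close>. The lower limits are taken in the extended reals, with \<open>R\<close> a real variable.\<close>

definition lower_density :: "(nat \<Rightarrow> nat) \<Rightarrow> (nat \<Rightarrow> nat \<Rightarrow> complex) \<Rightarrow> ereal" where
  "lower_density m z =
     Liminf at_top (\<lambda>R::real. Liminf sequentially (\<lambda>n.
       ereal (real (Min ((\<lambda>x. card (generation m z n \<inter> arc_between x (x + R / real n))) ` {0..2*pi}))
              / R)))"

end

theory Submission
  imports Defs "HOL-Computational_Algebra.Computational_Algebra" "HOL-Complex_Analysis.Complex_Analysis"
    "HOL-Real_Asymp.Real_Asymp"
begin

text \<open>Necessity. The polar derivative \<open>f + (a - z) f' / N\<close> maps polynomials of degree \<open>N\<close> to degree
  \<open>N - 1\<close> without increasing the sup norm on the circle, and it moves \<open>f\<close> by at most \<open>\<bar>z - a\<bar>\<close>.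
  Iterating it and multiplying with a Dirichlet kernel centred at \<open>a\<close> localizes \<open>f\<close> at a given scale
  while lowering the degree. An average over many scales shows that a sampling inequality for degree
  \<open>n\<close> implies a local one for degree \<open>(1 + \<eta>) n\<close>. If an arc of length \<open>R / n\<close> contained fewer than
  \<open>(1 + \<eta> / 4) R / (2 pi)\<close> points, a dimension count would yield a polynomial of that degree which
  vanishes on these points and attains its maximum well inside the arc.

  Sufficiency. If a normalised polynomial is very small on the sampling points, then blowing it up near
  its maximum by the factor \<open>n\<close> and subtracting a small interpolating polynomial gives an entire function of
  exponential type 1/2 with too many real zeros for Jensen's formula. The finitely many remaining degrees
  are handled by Lagrange interpolation.\<close>

section \<open>Bernstein-type inequalities and the polar derivative\<close>

text \<open>Counting alone cannot decide the theorem: determining a polynomial of degree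
  \<open>n\<close> already takes \<open>n + 1\<close> points, which is the critical density 1 / (2
  pi) itself. The strict inequality in the necessity part is therefore extracted from the gain of
  the factor \<open>1 + \<eta>\<close> in the degree, where \<open>\<eta>\<close> depends only on
  the sampling constant: part of the gain is spent on making the test polynomial decay, and the rest
  remains as density. In the converse direction, type 1/2 allows a logarithmic mean of r / pi on the
  circle of radius r, while zeros of density c on both sides of the centre force about 2 c r, which
  is larger exactly when c > 1 / (2 pi). Both arguments stay at finite scale with explicit
  constants, so no limit of the point sets is ever formed.\<close>

lemma poly_norm_le_disc:
  fixes p :: "complex poly"
  assumes "\<And>w. norm w = 1 \<Longrightarrow> norm (poly p w) \<le> B" "norm w \<le> 1"
  shows "norm (poly p w) \<le> B"
proof (rule maximum_modulus_frontier[of "poly p" "cball 0 1"])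
  show "poly p holomorphic_on interior (cball 0 1)"
    by (intro holomorphic_intros)
  show "continuous_on (closure (cball 0 1)) (poly p)"
    by (intro continuous_intros)
qed (use assms in auto)

text \<open>Outside the disc the maximum principle is applied to the reversed polynomial, which on
  the circle has the modulus of \<open>p\<close> at the inverse point.\<close>

lemma poly_norm_le_growth:
  fixes p :: "complex poly"
  assumes B: "\<And>w. norm w = 1 \<Longrightarrow> norm (poly p w) \<le> B" and deg: "degree p \<le> n"
  shows "norm (poly p w) \<le> B * max 1 (norm w) ^ n"
proof -
  have B0: "0 \<le> B"
    using B[of 1] norm_ge_zero[of "poly p 1"] by (simp del: norm_ge_zero)
  show ?thesis
  proof (cases "norm w \<le> 1")
    case True
    then show ?thesis
      using poly_norm_le_disc[OF B] by (simp add: max_def)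
  next
    case False
    then have w: "w \<noteq> 0" "norm w \<ge> 1" by auto
    have circle: "norm (poly (reflect_poly p) v) \<le> B" if "norm v = 1" for v
    proof -
      have "v \<noteq> 0" using that by auto
      then show ?thesis
        using that B[of "inverse v"]
        by (simp add: poly_reflect_poly_nz norm_mult norm_power norm_inverse)
    qed
    have "norm (poly (reflect_poly p) (inverse w)) \<le> B"
      by (rule poly_norm_le_disc[OF circle]) (use w in \<open>simp_all add: norm_inverse inverse_le_1_iff\<close>)
    then have "norm (poly p w) \<le> B * norm w ^ degree p"
      using w by (simp add: poly_reflect_poly_nz norm_mult norm_power norm_inverse norm_divide field_simps)
    also have "\<dots> \<le> B * norm w ^ n"
      using w deg B0 by (intro mult_left_mono power_increasing)
    finally show ?thesis using w by (simp add: max_def)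
  qed
qed

text \<open>Expanding the squared norm of \<open>\<zeta>\<close>, written as
  \<open>z - (z - \<zeta>)\<close>, shows that twice the real part of
  \<open>z * cnj (z - \<zeta>)\<close> is smaller than the squared norm of
  \<open>z - \<zeta>\<close>.\<close>

lemma Re_div_diff_le_half:
  fixes z \<zeta> :: complex
  assumes "norm z = 1" "norm \<zeta> > 1"
  shows "Re (z / (z - \<zeta>)) \<le> 1 / 2"
proof -
  have ne: "z \<noteq> \<zeta>" using assms by auto
  then have pos: "(Re z - Re \<zeta>)\<^sup>2 + (Im z - Im \<zeta>)\<^sup>2 > 0"
    by (metis complex_eq_iff diff_eq_diff_eq diff_self sum_power2_gt_zero_iff right_minus_eq)
  have z: "(Re z)\<^sup>2 + (Im z)\<^sup>2 = 1"
    using assms by (simp add: cmod_def)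
  have "1 < (Re \<zeta>)\<^sup>2 + (Im \<zeta>)\<^sup>2"
    using assms by (simp add: cmod_def)
  with z have "2 * (Re z * (Re z - Re \<zeta>) + Im z * (Im z - Im \<zeta>)) \<le> (Re z - Re \<zeta>)\<^sup>2 + (Im z - Im \<zeta>)\<^sup>2"
    by (simp add: power2_eq_square algebra_simps)
  then show ?thesis
    using pos by (simp add: Re_divide divide_simps)
qed

text \<open>The quotient is the sum of z / (z - zeta) over the roots zeta. All of them lie outside
  the closed disc, so each contributes at most 1/2.\<close>

lemma Re_logderiv_le:
  fixes p :: "complex poly"
  assumes "\<And>w. norm w \<le> 1 \<Longrightarrow> poly p w \<noteq> 0" "norm z = 1"
  shows "Re (z * poly (pderiv p) z / poly p z) \<le> degree p / 2"
  using assms(1)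
proof (induction "degree p" arbitrary: p)
  case 0
  then have "pderiv p = 0" by (simp add: pderiv_eq_0_iff)
  then show ?case by simp
next
  case (Suc d)
  from Suc.hyps(2)[symmetric] have "\<not> constant (poly p)"
    by (simp add: constant_degree)
  then obtain \<zeta> where \<zeta>: "poly p \<zeta> = 0"
    by (blast dest: Fundamental_Theorem_Algebra.fundamental_theorem_of_algebra)
  then obtain s where s: "p = [:-\<zeta>, 1:] * s"
    by (metis dvdE poly_eq_0_iff_dvd)
  have "p \<noteq> 0" using Suc.hyps by auto
  with s have "s \<noteq> 0" by auto
  have ds: "degree p = Suc (degree s)"
    unfolding s using \<open>s \<noteq> 0\<close> by (subst degree_mult_eq) auto
  have nz: "poly s w \<noteq> 0" if "norm w \<le> 1" for w
    using Suc.prems[OF that] s by auto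
  have \<zeta>1: "norm \<zeta> > 1"
    using Suc.prems[of \<zeta>] \<zeta> by force
  have IH: "Re (z * poly (pderiv s) z / poly s z) \<le> degree s / 2"
    using Suc.hyps ds nz by auto
  have ps: "pderiv p = s + [:-\<zeta>, 1:] * pderiv s"
    unfolding s by (subst pderiv_mult) (simp add: pderiv_pCons)
  have "z \<noteq> \<zeta>" "poly s z \<noteq> 0" using \<zeta>1 assms(2) nz by auto
  then have "z * poly (pderiv p) z / poly p z = z / (z - \<zeta>) + z * poly (pderiv s) z / poly s z"
    unfolding ps by (simp add: s divide_simps) (simp add: algebra_simps)
  then show ?case
    using IH Re_div_diff_le_half[OF assms(2) \<zeta>1] ds by simp
qed

text \<open>A constant \<open>c\<close> with \<open>\<bar>c\<bar> > B\<close> can be subtracted from \<open>f\<close> without creating zeros in the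
  disc; the bound on the logarithmic derivative of \<open>f - c\<close> then keeps \<open>N c\<close> away from
  \<open>N f - z f'\<close> by at least \<open>\<bar>f'\<bar>\<close>.\<close>

lemma bernstein_polar:
  fixes f :: "complex poly"
  assumes deg: "degree f \<le> N" and B: "\<And>w. norm w = 1 \<Longrightarrow> norm (poly f w) \<le> B"
    and z: "norm z = 1"
  shows "norm (poly (pderiv f) z) + norm (of_nat N * poly f z - z * poly (pderiv f) z) \<le> N * B"
proof (cases "N = 0")
  case True
  then have "pderiv f = 0" using deg by (simp add: pderiv_eq_0_iff)
  with True show ?thesis by simp
next
  case False
  define d where "d = norm (poly (pderiv f) z)"
  define Q where "Q = of_nat N * poly f z - z * poly (pderiv f) z"
  have away: "d \<le> norm (Q - of_nat N * c)" if c: "norm c > B" for c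
  proof -
    define p where "p = f - [:c:]"
    have nz: "poly p w \<noteq> 0" if "norm w \<le> 1" for w
      using poly_norm_le_disc[OF B that] c by (auto simp: p_def)
    have "degree p \<le> N"
      unfolding p_def using deg by (intro degree_diff_le) auto
    moreover define Y where "Y = z * poly (pderiv p) z / poly p z"
    ultimately have "2 * Re Y \<le> N"
      using Re_logderiv_le[OF nz z] by simp
    \<comment> \<open>Being no farther from 0 than from \<open>N\<close> amounts to
      \<open>2 * Re Y \<le> N\<close>; the two squared distances are compared.\<close>
    then have "real N * (2 * Re Y) \<le> real N * real N"
      by (intro mult_left_mono) auto
    then have "(norm Y)\<^sup>2 \<le> (norm (of_nat N - Y))\<^sup>2"
      unfolding cmod_power2 by (simp add: power2_eq_square algebra_simps)
    then have "norm Y * norm (poly p z) \<le> norm (of_nat N - Y) * norm (poly p z)"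
      by (intro mult_right_mono) (auto simp: power2_le_iff_abs_le)
    then have "norm (Y * poly p z) \<le> norm ((of_nat N - Y) * poly p z)"
      by (simp add: norm_mult)
    moreover have "Y * poly p z = z * poly (pderiv f) z"
      using nz[of z] z by (simp add: Y_def p_def pderiv_diff pderiv_pCons)
    ultimately have "norm (z * poly (pderiv f) z) \<le> norm (of_nat N * poly p z - z * poly (pderiv f) z)"
      by (simp add: algebra_simps)
    then show ?thesis
      using z by (simp add: norm_mult d_def Q_def p_def algebra_simps)
  qed
  show ?thesis
  proof (rule ccontr)
    assume "\<not> ?thesis"
    then have big: "d + norm Q > N * B" by (simp add: d_def Q_def)
    have NB: "N * B \<ge> 0" using order_trans[OF norm_ge_zero B[of 1]] by simp
    define u where "u = (if Q = 0 then 1 else sgn Q)"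
    have u: "Q = of_real (norm Q) * u" "norm u = 1"
      unfolding u_def by (simp_all add: norm_divide sgn_eq)
    \<comment> \<open>Taking \<open>c\<close> on the ray through \<open>Q\<close> turns the distance
      in \<open>away\<close> into a distance of real numbers.\<close>
    have rotate: "d \<le> \<bar>norm Q - t\<bar>" if "t > N * B" for t
    proof -
      have "norm (of_real (t / N) * u) > B"
      proof -
        have "t > 0" "B < t / N"
          using that False NB by (linarith, simp add: field_simps)
        then show ?thesis using u by (simp add: norm_mult norm_divide)
      qed
      then have "d \<le> norm (Q - of_nat N * (of_real (t / N) * u))"
        by (rule away)
      also have "Q - of_nat N * (of_real (t / N) * u) = of_real (norm Q - t) * u"
        using False by (subst u(1)) (simp add: algebra_simps)
      finally show ?thesis using u(2) by (simp only: norm_mult norm_of_real mult_1_right)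
    qed
    show False
    proof (cases "norm Q > N * B")
      case True
      from rotate[OF this] have "poly (pderiv f) z = 0" by (simp add: d_def)
      then have "norm Q = N * norm (poly f z)" by (simp add: Q_def norm_mult)
      also have "\<dots> \<le> N * B" using B[OF z] by (intro mult_left_mono) auto
      finally show False using True by simp
    next
      case False
      \<comment> \<open>Any \<open>t\<close> above \<open>N * B\<close> at distance less than
        \<open>d\<close> from \<open>norm Q\<close> contradicts \<open>rotate\<close>; the midpoint
        of \<open>N * B\<close> and \<open>d + norm Q\<close> qualifies.\<close>
      define t where "t = (N * B + d + norm Q) / 2"
      have "y < (y + d + x) / 2 \<and> x \<le> (y + d + x) / 2 \<and> (y + d + x) / 2 - x < d"
        if "y < d + x" "\<not> y < x" for x y :: real
        using that by (simp add: field_simps)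
      from this[OF big False] rotate[of t] show False
        unfolding t_def[symmetric] by linarith
    qed
  qed
qed

text \<open>The coefficient of degree \<open>Suc N\<close> cancels. The multiple
  \<open>M * g\<close> is the sum of a f' and M f - w f', which \<open>bernstein_polar\<close>
  bounds together; the same inequality bounds f' alone and hence the error.\<close>

lemma polar_reduction_step:
  fixes f :: "complex poly"
  assumes deg: "degree f \<le> Suc N" and B: "\<And>w. norm w = 1 \<Longrightarrow> norm (poly f w) \<le> B"
    and a: "norm a = 1"
  obtains g where "degree g \<le> N" "\<And>w. norm w = 1 \<Longrightarrow> norm (poly g w) \<le> B"
    "poly g a = poly f a" "\<And>w. norm w = 1 \<Longrightarrow> norm (poly g w - poly f w) \<le> B * norm (w - a)"
proof
  define M where "M = Suc N"
  define g where "g = f + smult (1 / of_nat M) ([:a, -1:] * pderiv f)"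
  have M0: "real M > 0" by (simp add: M_def)
  have g: "poly g w = poly f w + (a - w) * poly (pderiv f) w / of_nat M" for w
    by (simp add: g_def left_diff_distrib)
  show "poly g a = poly f a" by (simp add: g)
  have dd: "degree (pderiv f) \<le> N" using deg by (simp add: degree_pderiv)
  have "coeff g M = 0"
  proof -
    have "coeff ([:a, -1:] * pderiv f) M = a * coeff (pderiv f) M - coeff (pderiv f) N"
      by (simp add: M_def)
    also have "coeff (pderiv f) M = 0"
      using dd by (intro coeff_eq_0) (simp add: M_def)
    also have "coeff (pderiv f) N = of_nat M * coeff f M"
      by (simp add: coeff_pderiv M_def)
    finally show ?thesis using M0 by (simp add: g_def field_simps)
  qed
  moreover have "degree g \<le> M"
    unfolding g_def M_def using deg dd
    by (intro degree_add_le order_trans[OF degree_smult_le] order_trans[OF degree_mult_le]) auto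
  ultimately show "degree g \<le> N"
    by (metis M_def eq_zero_or_degree_less degree_0 le0 less_Suc_eq_le)
  fix w :: complex assume w: "norm w = 1"
  note bp = bernstein_polar[OF deg B w, folded M_def]
  have "of_nat M * poly g w = a * poly (pderiv f) w + (of_nat M * poly f w - w * poly (pderiv f) w)"
    using M0 by (simp add: g field_simps)
  then have "norm (of_nat M * poly g w) \<le> norm (poly (pderiv f) w)
      + norm (of_nat M * poly f w - w * poly (pderiv f) w)"
    by (metis norm_triangle_ineq norm_mult a mult_1)
  then have "M * norm (poly g w) \<le> M * B" using bp by (simp add: norm_mult)
  then show "norm (poly g w) \<le> B" using M0 by simp
  have "norm (poly (pderiv f) w) \<le> M * B"
    using bp by (meson add_increasing2 dual_order.trans norm_ge_zero order_refl)
  then have "norm (poly (pderiv f) w) / M \<le> B" using M0 by (simp add: field_simps)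
  then have "norm (w - a) * (norm (poly (pderiv f) w) / M) \<le> norm (w - a) * B"
    by (intro mult_left_mono) auto
  then show "norm (poly g w - poly f w) \<le> B * norm (w - a)"
    by (simp add: g norm_mult norm_divide norm_minus_commute mult.commute)
qed

lemma polar_reduction:
  fixes f :: "complex poly"
  assumes deg: "degree f \<le> N + l" and B: "\<And>w. norm w = 1 \<Longrightarrow> norm (poly f w) \<le> B"
    and a: "norm a = 1"
  obtains g where "degree g \<le> N" "\<And>w. norm w = 1 \<Longrightarrow> norm (poly g w) \<le> B"
    "poly g a = poly f a" "\<And>w. norm w = 1 \<Longrightarrow> norm (poly g w - poly f w) \<le> l * B * norm (w - a)"
  using deg B
proof (induction l arbitrary: f thesis)
  case 0
  then show ?case by (auto intro: 0(1)[of f])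
next
  case (Suc l)
  obtain h where h: "degree h \<le> N + l" "\<And>w. norm w = 1 \<Longrightarrow> norm (poly h w) \<le> B"
    "poly h a = poly f a" "\<And>w. norm w = 1 \<Longrightarrow> norm (poly h w - poly f w) \<le> B * norm (w - a)"
    using polar_reduction_step[of f "N + l" B a] Suc.prems a by (metis add_Suc_right)
  obtain g where g: "degree g \<le> N" "\<And>w. norm w = 1 \<Longrightarrow> norm (poly g w) \<le> B"
    "poly g a = poly h a" "\<And>w. norm w = 1 \<Longrightarrow> norm (poly g w - poly h w) \<le> l * B * norm (w - a)"
    using Suc.IH[OF _ h(1,2)] by blast
  have "norm (poly g w - poly f w) \<le> Suc l * B * norm (w - a)" if "norm w = 1" for w
    using norm_triangle_ineq[of "poly g w - poly h w" "poly h w - poly f w"] g(4)[OF that] h(4)[OF that]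
    by (simp add: algebra_simps)
  then show ?case using g h by (intro Suc.prems(1)[of g]) auto
qed

section \<open>Sampling inequalities survive a small increase of the degree\<close>

text \<open>The kernel is one-sided, with frequencies from 0 to \<open>L - 1\<close>, so that it is
  an ordinary polynomial; it is normalised to the value 1 at \<open>v\<close>.\<close>

definition dirichlet_kernel :: "nat \<Rightarrow> complex \<Rightarrow> complex poly" where
  "dirichlet_kernel L v = (\<Sum>k<L. monom (inverse (of_nat L) * inverse v ^ k) k)"

lemma degree_dirichlet_kernel: "degree (dirichlet_kernel L v) \<le> L - 1"
  unfolding dirichlet_kernel_def
  by (intro degree_sum_le) (auto intro: order_trans[OF degree_monom_le])

lemma poly_dirichlet_kernel:
  "poly (dirichlet_kernel L v) w = (\<Sum>k<L. (w / v) ^ k) / of_nat L"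
  by (simp add: dirichlet_kernel_def poly_sum poly_monom sum_divide_distrib divide_inverse sum_distrib_left
      power_mult_distrib power_inverse mult_ac)

lemma dirichlet_kernel_self:
  assumes "L > 0" "v \<noteq> 0"
  shows "poly (dirichlet_kernel L v) v = 1"
  using assms by (simp add: poly_dirichlet_kernel)

lemma norm_dirichlet_kernel_le_1:
  assumes "norm v = 1" "norm w = 1"
  shows "norm (poly (dirichlet_kernel L v) w) \<le> 1"
proof -
  have "norm (\<Sum>k<L. (w / v) ^ k) \<le> (\<Sum>k<L. 1)"
    by (rule order_trans[OF norm_sum]) (simp add: norm_power norm_divide assms)
  then show ?thesis
    by (simp add: poly_dirichlet_kernel norm_divide divide_simps)
qed

text \<open>The geometric sum telescopes to (w / v)^L - 1, of modulus at most 2. The product form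
  covers \<open>w = v\<close>.\<close>

lemma norm_dirichlet_kernel_decay:
  assumes "norm v = 1" "norm w = 1" "L > 0"
  shows "norm (poly (dirichlet_kernel L v) w) * (L * norm (w - v)) \<le> 2"
proof -
  have v: "v \<noteq> 0" using assms by auto
  have "(w / v) ^ L - 1 = (w / v - 1) * (\<Sum>k<L. (w / v) ^ k)"
    by (rule power_diff_1_eq)
  also have "\<dots> = (w - v) / v * (of_nat L * poly (dirichlet_kernel L v) w)"
    using assms(3) v by (simp add: poly_dirichlet_kernel diff_divide_distrib)
  finally have "norm (poly (dirichlet_kernel L v) w) * (L * norm (w - v)) = norm ((w / v) ^ L - 1)"
    using assms by (simp add: norm_mult norm_divide)
  also have "\<dots> \<le> norm ((w / v) ^ L) + 1"
    by (rule order_trans[OF norm_triangle_ineq4]) simp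
  also have "\<dots> = 2" using assms by (simp add: norm_power norm_divide)
  finally show ?thesis .
qed

text \<open>Lowering the degree by \<open>l\<close>, at most three times n / S, absorbs the excess
  degree of \<open>f\<close> and frees \<open>L\<close> degrees for a kernel. Near \<open>a\<close>
  the reduction has moved \<open>f\<close> only a little, far from \<open>a\<close> the kernel is
  small; in between only the bound 1 is claimed.\<close>

lemma localized_reduction:
  fixes f :: "complex poly" and A S \<eta> :: real
  assumes A: "A > 0" and S: "S \<ge> 1" and n: "real n \<ge> S"
    and deg: "real (degree f) \<le> (1 + \<eta>) * n" and \<eta>: "\<eta> \<ge> 0" "\<eta> \<le> 1 / S"
    and B: "\<And>w. norm w = 1 \<Longrightarrow> norm (poly f w) \<le> 1" and a: "norm a = 1"
  obtains g where "degree g \<le> n" "poly g a = poly f a"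
    "\<And>w. norm w = 1 \<Longrightarrow> norm (poly g w) \<le> 1"
    "\<And>w. norm w = 1 \<Longrightarrow> n * norm (w - a) \<le> S / A \<Longrightarrow> poly f w = 0 \<Longrightarrow> norm (poly g w) \<le> 3 / A"
    "\<And>w. norm w = 1 \<Longrightarrow> n * norm (w - a) \<ge> A * S \<Longrightarrow> norm (poly g w) \<le> 3 / A"
proof -
  define L where "L = nat \<lceil>n / S\<rceil>"
  define l where "l = degree f - n + L"
  have n0: "real n > 0" using n S by linarith
  have a0: "a \<noteq> 0" using a by auto
  have Lge: "L \<ge> n / S" unfolding L_def by (rule real_nat_ceiling_ge)
  have L0: "L > 0" unfolding L_def using n0 S by simp
  have "n / S \<le> n" using S n0 by (simp add: field_simps)
  then have Ln: "L \<le> n" unfolding L_def by (simp add: nat_le_iff ceiling_le_iff)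
  have "real (degree f - n) \<le> \<eta> * n"
    using deg \<eta> n0 by (cases "n \<le> degree f") (simp_all add: of_nat_diff algebra_simps)
  also have "\<dots> \<le> n / S" using \<eta> n0 mult_right_mono[of \<eta> "1 / S" "real n"] by simp
  finally have "real (degree f - n) \<le> n / S" .
  moreover have "real L \<le> n / S + 1"
    unfolding L_def using n0 S by (simp add: of_nat_nat ceiling_correct)
  moreover have "1 \<le> n / S" using n S by (simp add: field_simps)
  ultimately have l: "real l \<le> 3 * (n / S)"
    unfolding l_def of_nat_add by linarith
  have "degree f \<le> (n - L) + l" using Ln by (simp add: l_def)
  from polar_reduction[OF this, of 1 a] B a obtain h where h: "degree h \<le> n - L"
    "\<And>w. norm w = 1 \<Longrightarrow> norm (poly h w) \<le> 1" "poly h a = poly f a"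
    "\<And>w. norm w = 1 \<Longrightarrow> norm (poly h w - poly f w) \<le> real l * 1 * norm (w - a)"
    by blast
  define g where "g = h * dirichlet_kernel L a"
  have g_le: "norm (poly g w) \<le> norm (poly h w)" if "norm w = 1" for w
    using mult_left_mono[OF norm_dirichlet_kernel_le_1[OF a that], of "norm (poly h w)" L]
    by (simp add: g_def norm_mult)
  show thesis
  proof (rule that[of g])
    show "degree g \<le> n"
      unfolding g_def using h(1) degree_dirichlet_kernel[of L a] Ln
      by (intro order_trans[OF degree_mult_le]) linarith
    show "poly g a = poly f a"
      using dirichlet_kernel_self[OF L0 a0] h(3) by (simp add: g_def)
    fix w :: complex assume w: "norm w = 1"
    show "norm (poly g w) \<le> 1" using g_le[OF w] h(2)[OF w] by linarith
    show "norm (poly g w) \<le> 3 / A" if near: "n * norm (w - a) \<le> S / A" and fw: "poly f w = 0"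
    proof -
      have "norm (poly g w) \<le> l * norm (w - a)"
        using g_le[OF w] h(4)[OF w] fw by simp
      also have "\<dots> \<le> 3 * (n / S) * norm (w - a)" by (intro mult_right_mono l) auto
      also have "\<dots> = 3 / S * (n * norm (w - a))" by simp
      also have "\<dots> \<le> 3 / S * (S / A)" using near S by (intro mult_left_mono) auto
      also have "\<dots> = 3 / A" using S by simp
      finally show ?thesis .
    qed
    show "norm (poly g w) \<le> 3 / A" if far: "n * norm (w - a) \<ge> A * S"
    proof -
      define D where "D = norm (poly (dirichlet_kernel L a) w)"
      have "A \<le> n / S * norm (w - a)" using far S by (simp add: field_simps)
      also have "\<dots> \<le> L * norm (w - a)" by (intro mult_right_mono Lge) auto
      finally have "D * A \<le> D * (L * norm (w - a))"
        unfolding D_def by (intro mult_left_mono) auto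
      also have "\<dots> \<le> 2" unfolding D_def by (rule norm_dirichlet_kernel_decay[OF a w L0])
      finally have "D \<le> 3 / A" using A by (simp add: field_simps)
      moreover have "norm (poly g w) \<le> D"
        using mult_right_mono[OF h(2)[OF w], of D] by (simp add: g_def norm_mult D_def)
      ultimately show ?thesis by linarith
    qed
  qed
qed

text \<open>Averaging the localized reductions of \<open>f\<close> over many well separated scales \<open>S\<close> keeps the
  value at \<open>a\<close>, while at each sampling point only one scale contributes more than \<open>3 / A\<close>. This
  lets a sampling inequality for degree \<open>n\<close> survive a slight increase of the degree.\<close>

lemma local_sampling:
  fixes C :: real
  assumes "C > 0"
  obtains T \<eta> n0 where "T > 0" "\<eta> > 0"
    "\<And>n (Z :: complex set) a f. real n \<ge> n0 \<Longrightarrow> Z \<subseteq> sphere 0 1 \<Longrightarrow>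
      (\<And>q B. degree q \<le> n \<Longrightarrow> (\<And>w. w \<in> Z \<Longrightarrow> norm (poly q w) \<le> B) \<Longrightarrow> norm (poly q a) \<le> C * B) \<Longrightarrow>
      real (degree f) \<le> (1 + \<eta>) * n \<Longrightarrow> (\<And>w. norm w = 1 \<Longrightarrow> norm (poly f w) \<le> 1) \<Longrightarrow>
      norm a = 1 \<Longrightarrow> norm (poly f a) = 1 \<Longrightarrow>
      \<exists>w\<in>Z. n * norm (w - a) \<le> T \<and> poly f w \<noteq> 0"
proof -
  \<comment> \<open>The average is taken without dividing: the sum of \<open>A\<close> reductions
    has modulus \<open>A\<close> at \<open>a\<close> and at most 4 on \<open>Z\<close>.\<close>
  obtain A :: nat where A: "real A > 4 * C" using reals_Archimedean2 by blast
  then have A0: "real A > 0" using assms by linarith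
  \<comment> \<open>The ratio \<open>A ^ 2\<close> of consecutive scales makes the windows between
    \<open>S k / A\<close> and \<open>A * S k\<close> disjoint.\<close>
  define S where "S k = real A ^ (2 * k)" for k
  have S1: "S k \<ge> 1" for k using A0 by (simp add: S_def)
  have Smono: "S k \<le> S k'" if "k \<le> k'" for k k'
    using that A0 by (simp add: S_def power_increasing)
  show thesis
  proof (rule that[of "S A" "1 / S A" "S A"])
    show "S A > 0" "1 / S A > 0" using S1[of A] by auto
    fix n and Z :: "complex set" and a and f :: "complex poly"
    assume n: "S A \<le> real n" and Z: "Z \<subseteq> sphere 0 1"
      and samp: "\<And>q B. degree q \<le> n \<Longrightarrow> (\<And>w. w \<in> Z \<Longrightarrow> norm (poly q w) \<le> B) \<Longrightarrow> norm (poly q a) \<le> C * B"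
      and f: "real (degree f) \<le> (1 + 1 / S A) * n" "\<And>w. norm w = 1 \<Longrightarrow> norm (poly f w) \<le> 1"
      and a: "norm a = 1" "norm (poly f a) = 1"
    show "\<exists>w\<in>Z. n * norm (w - a) \<le> S A \<and> poly f w \<noteq> 0"
    proof (rule ccontr)
      assume "\<not> ?thesis"
      then have zero: "poly f w = 0" if "w \<in> Z" "n * norm (w - a) \<le> S A" for w
        using that by blast
      have "\<exists>g. degree g \<le> n \<and> poly g a = poly f a \<and>
         (\<forall>w\<in>Z. norm (poly g w) \<le> 1 \<and>
           (n * norm (w - a) \<le> S k / A \<or> n * norm (w - a) \<ge> A * S k \<longrightarrow> norm (poly g w) \<le> 3 / A))"
        if k: "k < A" for k
      proof -
        have "1 / S A \<le> 1 / S k" "S k \<le> n"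
          using Smono[of k A] S1[of k] n k by (auto simp: divide_simps)
        then obtain g where g: "degree g \<le> n" "poly g a = poly f a"
          "\<And>w. norm w = 1 \<Longrightarrow> norm (poly g w) \<le> 1"
          "\<And>w. norm w = 1 \<Longrightarrow> n * norm (w - a) \<le> S k / A \<Longrightarrow> poly f w = 0 \<Longrightarrow> norm (poly g w) \<le> 3 / A"
          "\<And>w. norm w = 1 \<Longrightarrow> n * norm (w - a) \<ge> A * S k \<Longrightarrow> norm (poly g w) \<le> 3 / A"
          using localized_reduction[OF A0 S1[of k] _ f(1) _ _ f(2) a(1)] \<open>S A > 0\<close>
          by (metis divide_nonneg_nonneg less_eq_real_def zero_le_one)
        have "S k / A \<le> S k" using A0 S1[of k] by (simp add: field_simps)
        also have "\<dots> \<le> S A" using Smono[of k A] k by simp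
        finally show ?thesis using g Z zero by (intro exI[of _ g]) force
      qed
      then obtain g where g: "\<And>k. k < A \<Longrightarrow> degree (g k) \<le> n" "\<And>k. k < A \<Longrightarrow> poly (g k) a = poly f a"
        "\<And>k w. k < A \<Longrightarrow> w \<in> Z \<Longrightarrow> norm (poly (g k) w) \<le> 1"
        "\<And>k w. k < A \<Longrightarrow> w \<in> Z \<Longrightarrow> n * norm (w - a) \<le> S k / A \<or> n * norm (w - a) \<ge> A * S k \<Longrightarrow>
           norm (poly (g k) w) \<le> 3 / A"
        by metis
      define q where "q = (\<Sum>k<A. g k)"
      have deg_q: "degree q \<le> n" unfolding q_def by (intro degree_sum_le) (use g in auto)
      have qZ: "norm (poly q w) \<le> 4" if w: "w \<in> Z" for w
      proof -
        define t where "t = n * norm (w - a)"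
        \<comment> \<open>The scales at which \<open>w\<close> is neither near nor far. There is at
          most one of them, bounded by 1; all the others together contribute at most 3.\<close>
        define K where "K = {k\<in>{..<A}. S k / A < t \<and> t < A * S k}"
        have "k = k'" if "k \<in> K" "k' \<in> K" "k \<le> k'" for k k'
        proof (rule ccontr)
          assume "k \<noteq> k'"
          then have "S (Suc k) \<le> S k'" using that by (intro Smono) auto
          then have "A * S k * A \<le> S k'" by (simp add: S_def power2_eq_square mult_ac)
          then have "A * S k \<le> S k' / A" using A0 by (simp add: field_simps)
          then show False using that by (auto simp: K_def)
        qed
        then have "card K \<le> 1"
          by (metis (no_types, lifting) One_nat_def card_le_Suc0_iff_eq K_def finite_lessThan
              finite_Collect_conjI finite_subset[of K "{..<A}"] mem_Collect_eq subsetI linear)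
        have "norm (poly q w) \<le> (\<Sum>k<A. norm (poly (g k) w))"
          unfolding q_def poly_sum by (rule norm_sum)
        also have "\<dots> \<le> (\<Sum>k<A. 3 / A + (if k \<in> K then 1 else 0))"
        proof (rule sum_mono)
          fix k assume "k \<in> {..<A}"
          then show "norm (poly (g k) w) \<le> 3 / A + (if k \<in> K then 1 else 0)"
            using g(3)[of k w] g(4)[of k w] w A0
            by (auto simp: K_def t_def not_less intro: add_increasing)
        qed
        also have "\<dots> = 3 + card K"
        proof -
          have "{..<A} \<inter> {k. k \<in> K} = K" by (auto simp: K_def)
          then show ?thesis using A0 by (simp add: sum.distrib sum.If_cases)
        qed
        also have "\<dots> \<le> 4" using \<open>card K \<le> 1\<close> by simp
        finally show ?thesis .
      qed
      have "poly q a = of_nat A * poly f a" using g(2) by (simp add: q_def poly_sum)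
      then have "A = norm (poly q a)" using a by (simp add: norm_mult)
      also have "\<dots> \<le> C * 4" by (rule samp[OF deg_q qZ])
      finally show False using A by simp
    qed
  qed
qed

section \<open>Arcs and chords of the unit circle\<close>

lemma mult_cos_le_sin:
  fixes x :: real
  assumes "0 \<le> x" "x \<le> pi / 2"
  shows "x * cos x \<le> sin x"
proof -
  have "(\<lambda>t. sin t - t * cos t) 0 \<le> (\<lambda>t. sin t - t * cos t) x"
  proof (rule DERIV_nonneg_imp_nondecreasing[OF assms(1)])
    fix t :: real assume t: "0 \<le> t" "t \<le> x"
    have "((\<lambda>t. sin t - t * cos t) has_real_derivative t * sin t) (at t)"
      by (auto intro!: derivative_eq_intros)
    moreover have "sin t \<ge> 0" using t assms by (intro sin_ge_zero) auto
    ultimately show "\<exists>y. ((\<lambda>t. sin t - t * cos t) has_real_derivative y) (at t) \<and> 0 \<le> y"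
      using t by (intro exI[of _ "t * sin t"]) auto
  qed
  then show ?thesis by simp
qed

text \<open>With \<open>u\<close> a quarter of the angle, half the chord is sin (2 u) = 2 sin u cos
  u, which is at least 2 u (cos u)^2 = u (1 + cos (2 u)); the last cosine is nonnegative since 2 u
  is at most pi / 2.\<close>

lemma arc_le_chord:
  fixes t :: real
  assumes "\<bar>t\<bar> \<le> pi"
  shows "\<bar>t\<bar> \<le> 2 * norm (cis t - 1)"
proof -
  define u where "u = \<bar>t\<bar> / 4"
  have u: "0 \<le> u" "u \<le> pi / 4" using assms by (auto simp: u_def)
  have "u \<le> u * (1 + cos (2 * u))"
    using u cos_ge_zero[of "2 * u"] by (simp add: algebra_simps)
  also have "\<dots> = 2 * (u * cos u) * cos u"
    by (simp add: cos_double_cos power2_eq_square)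
  also have "\<dots> \<le> 2 * sin u * cos u"
    using mult_cos_le_sin[of u] cos_ge_zero[of u] u by (intro mult_right_mono mult_left_mono) auto
  also have "\<dots> = sin (\<bar>t\<bar> / 2)"
    using sin_double[of u] by (simp add: u_def)
  also have "\<dots> \<le> \<bar>sin (t / 2)\<bar>" by (cases "t \<ge> 0") auto
  also have "\<dots> = norm (cis t - 1) / 2"
    using dist_exp_i_1[of t] by (simp add: cis_conv_exp)
  finally show ?thesis by (simp add: u_def)
qed

lemma unit_circle_close_cis:
  assumes "norm u = 1" "norm v = 1"
  obtains t where "u = v * cis t" "\<bar>t\<bar> \<le> 2 * norm (u - v)"
proof
  have v: "v \<noteq> 0" using assms by auto
  define t where "t = Arg (u / v)"
  have t: "cis t = u / v"
    using assms unfolding t_def by (subst cis_Arg) (auto simp: sgn_div_norm norm_divide)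
  then show "u = v * cis t" using v by simp
  have "\<bar>t\<bar> \<le> pi" using mpi_less_Arg[of "u / v"] Arg_le_pi[of "u / v"] by (simp add: t_def)
  then have "\<bar>t\<bar> \<le> 2 * norm (cis t - 1)" by (rule arc_le_chord)
  also have "cis t - 1 = (u - v) / v" using v by (simp add: t diff_divide_distrib)
  finally show "\<bar>t\<bar> \<le> 2 * norm (u - v)" using assms by (simp add: norm_divide)
qed

text \<open>A homogeneous system with more unknowns than equations. One step of Gaussian elimination
  removes the point \<open>w\<close> and a pivot index \<open>k\<close>.\<close>

lemma exists_combination_vanishing:
  fixes \<phi> :: "'i \<Rightarrow> 'w \<Rightarrow> 'a :: field"
  assumes "finite W" "finite J" "card W < card J"
  shows "\<exists>a. (\<exists>j\<in>J. a j \<noteq> 0) \<and> (\<forall>w\<in>W. (\<Sum>j\<in>J. a j * \<phi> j w) = 0)"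
  using assms
proof (induction W arbitrary: J \<phi> rule: finite_induct)
  case empty
  then have "J \<noteq> {}" by auto
  then show ?case by (intro exI[of _ "\<lambda>_. 1"]) auto
next
  case (insert w W)
  show ?case
  proof (cases "\<forall>j\<in>J. \<phi> j w = 0")
    case True
    obtain a where "\<exists>j\<in>J. a j \<noteq> 0" "\<forall>w\<in>W. (\<Sum>j\<in>J. a j * \<phi> j w) = 0"
      using insert.IH[of J \<phi>] insert.prems insert.hyps by auto
    then show ?thesis using True by (intro exI[of _ a]) auto
  next
    case False
    then obtain k where k: "k \<in> J" "\<phi> k w \<noteq> 0" by auto
    define \<psi> where "\<psi> j x = \<phi> j x - \<phi> j w / \<phi> k w * \<phi> k x" for j x
    have "card W < card (J - {k})"
      using insert.prems insert.hyps k by simp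
    then obtain a where a: "\<exists>j\<in>J - {k}. a j \<noteq> 0" "\<forall>w\<in>W. (\<Sum>j\<in>J - {k}. a j * \<psi> j w) = 0"
      using insert.IH[of "J - {k}" \<psi>] insert.prems by auto
    define b where "b = a(k := - (\<Sum>j\<in>J - {k}. a j * (\<phi> j w / \<phi> k w)))"
    have b: "(\<Sum>j\<in>J. b j * \<phi> j x) = (\<Sum>j\<in>J - {k}. a j * \<psi> j x)" for x
    proof -
      have "(\<Sum>j\<in>J. b j * \<phi> j x) = b k * \<phi> k x + (\<Sum>j\<in>J - {k}. b j * \<phi> j x)"
        using insert.prems k by (simp add: sum.remove)
      also have "(\<Sum>j\<in>J - {k}. b j * \<phi> j x) = (\<Sum>j\<in>J - {k}. a j * \<phi> j x)"
        by (intro sum.cong) (auto simp: b_def)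
      finally show ?thesis
        by (simp add: b_def \<psi>_def algebra_simps sum_subtractf sum_distrib_left)
    qed
    have "\<psi> j w = 0" for j using k by (simp add: \<psi>_def)
    then have "\<forall>x\<in>insert w W. (\<Sum>j\<in>J. b j * \<phi> j x) = 0" using a b by simp
    moreover have "\<exists>j\<in>J. b j \<noteq> 0" using a by (auto simp: b_def)
    ultimately show ?thesis by blast
  qed
qed

lemma dirichlet_kernel_eq_0:
  assumes "w ^ L = v ^ L" "w \<noteq> v" "v \<noteq> 0"
  shows "poly (dirichlet_kernel L v) w = 0"
proof -
  have "(w / v - 1) * (\<Sum>k<L. (w / v) ^ k) = 0"
    using power_diff_1_eq[of "w / v" L] assms by (simp add: power_divide)
  then show ?thesis using assms by (simp add: poly_dirichlet_kernel)
qed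

text \<open>Turns the suprema of the definition into the pointwise form that
  \<open>local_sampling\<close> expects.\<close>

lemma MZ_sampling:
  assumes "n \<ge> 1"
    and MZ: "\<forall>n\<ge>1. \<forall>q :: complex poly. degree q \<le> n \<longrightarrow>
        (SUP w\<in>sphere 0 1. norm (poly q w)) \<le> C * (SUP j\<in>{..m n}. norm (poly q (z n j)))"
    and C: "C > 0" and q: "degree q \<le> n"
    and B: "\<And>w. w \<in> generation m z n \<Longrightarrow> norm (poly q w) \<le> B" and a: "norm a = 1"
  shows "norm (poly q a) \<le> C * B"
proof -
  have "compact ((\<lambda>w. norm (poly q w)) ` sphere 0 1)"
    by (intro compact_continuous_image continuous_intros) auto
  then have "norm (poly q a) \<le> (SUP w\<in>sphere 0 1. norm (poly q w))"
    using a by (intro cSUP_upper bounded_imp_bdd_above compact_imp_bounded) auto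
  also have "\<dots> \<le> C * (SUP j\<in>{..m n}. norm (poly q (z n j)))"
    using MZ assms(1) q by blast
  also have "\<dots> \<le> C * B"
    using C B by (intro mult_left_mono cSUP_least) (auto simp: generation_def)
  finally show ?thesis .
qed

section \<open>Necessity of the density condition\<close>

lemma real_nat_ceiling_less: "x \<ge> 0 \<Longrightarrow> real (nat \<lceil>x\<rceil>) < x + 1"
  using ceiling_correct[of x] by simp

lemma real_nat_floor_bounds:
  assumes "x \<ge> 0"
  shows "real (nat \<lfloor>x\<rfloor>) \<le> x" "x < real (nat \<lfloor>x\<rfloor>) + 1"
  using assms floor_correct[of x] by simp_all

text \<open>The kernels of order \<open>P\<close> at \<open>V\<close> consecutive points of a rotated grid of \<open>P\<close>-th roots of
  unity interpolate on these points; the squares of the kernels of order \<open>L\<close> make the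
  combinations small away from them, so that their maximum is attained nearby.\<close>

lemma exists_localized_vanishing_poly:
  fixes W :: "complex set" and y b :: real
  assumes W: "finite W" "card W < V" and VP: "V \<le> P" and L: "L > 0" and b: "b > 0"
    and decay: "V * (2 / (L * b))\<^sup>2 < 1"
  obtains f a and j :: nat where "degree f \<le> P - 1 + 2 * (L - 1)" "\<And>w. norm w = 1 \<Longrightarrow> norm (poly f w) \<le> 1"
    "norm a = 1" "norm (poly f a) = 1" "j < V" "norm (a - cis (y + 2 * pi * j / P)) < b"
    "\<And>w. w \<in> W \<Longrightarrow> poly f w = 0"
proof -
  have P0: "P > 0" using W VP by linarith
  define v where "v j = cis (y + 2 * pi * real j / P)" for j :: nat
  have v1: "norm (v j) = 1" for j by (simp add: v_def)
  then have v0: "v j \<noteq> 0" for j by (metis norm_zero zero_neq_one)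
  have vP: "v i ^ P = v j ^ P" for i j
  proof -
    have "v k ^ P = cis (P * y)" for k
    proof -
      have "v k ^ P = cis (P * (y + 2 * pi * real k / P))" unfolding v_def by (rule Complex.DeMoivre)
      also have "P * (y + 2 * pi * real k / P) = P * y + 2 * pi * real k"
        using P0 by (simp add: field_simps)
      finally show ?thesis by (simp add: cis_mult[symmetric] cis_multiple_2pi)
    qed
    then show ?thesis by simp
  qed
  have v_inj: "v i \<noteq> v j" if "i < P" "j < P" "i \<noteq> j" for i j
  proof
    assume "v i = v j"
    then have "cis (2 * pi * real i / P) = cis (2 * pi * real j / P)"
      by (simp add: v_def cis_mult[symmetric])
    with that bij_betw_imp_inj_on[OF Complex.bij_betw_roots_unity[OF P0]] show False
      by (auto simp: inj_on_def)
  qed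
  \<comment> \<open>The unsquared kernel would give a sum of order \<open>V / (L * b)\<close>, where
    in the application numerator and denominator both grow like \<open>R\<close>; the square gains
    the missing factor.\<close>
  define \<phi> where "\<phi> j = dirichlet_kernel P (v j) * (dirichlet_kernel L (v j))\<^sup>2" for j
  have \<phi>_node: "poly (\<phi> j) (v i) = (if i = j then 1 else 0)" if "i < P" "j < P" for i j
    using that dirichlet_kernel_self[OF P0 v0] dirichlet_kernel_self[OF L v0]
      dirichlet_kernel_eq_0[OF vP v_inj v0] by (simp add: \<phi>_def)
  obtain a where a: "\<exists>j\<in>{..<V}. a j \<noteq> 0" "\<forall>w\<in>W. (\<Sum>j<V. a j * poly (\<phi> j) w) = 0"
    using exists_combination_vanishing[OF W(1), of "{..<V}" "\<lambda>j. poly (\<phi> j)"] W(2) by auto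
  define M where "M = Max ((\<lambda>j. norm (a j)) ` {..<V})"
  have "M \<in> (\<lambda>j. norm (a j)) ` {..<V}" unfolding M_def using a by (intro Max_in) auto
  then obtain k where k: "k < V" "norm (a k) = M" by auto
  have aM: "norm (a j) \<le> M" if "j < V" for j unfolding M_def using that by (intro Max_ge) auto
  have M0: "M > 0" using a(1) aM by (metis lessThan_iff norm_le_zero_iff not_less order_trans)
  define F where "F = (\<Sum>j<V. smult (a j) (\<phi> j))"
  have F: "poly F w = (\<Sum>j<V. a j * poly (\<phi> j) w)" for w by (simp add: F_def poly_sum)
  have Fk: "norm (poly F (v k)) = M"
  proof -
    have "poly F (v k) = (\<Sum>j<V. if k = j then a j else 0)"
      unfolding F using k VP by (intro sum.cong) (auto simp: \<phi>_node)
    then show ?thesis using k by simp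
  qed
  \<comment> \<open>At the node \<open>v k\<close> the modulus is already \<open>M\<close>, so
    smaller values away from all nodes force the maximum to lie within \<open>b\<close> of some
    node.\<close>
  have far: "norm (poly F w) < M"
    if w: "norm w = 1" and away: "\<And>j. j < V \<Longrightarrow> norm (w - v j) \<ge> b" for w
  proof -
    have "norm (a j * poly (\<phi> j) w) \<le> M * (2 / (L * b))\<^sup>2" if j: "j < V" for j
    proof -
      define D where "D = norm (poly (dirichlet_kernel L (v j)) w)"
      have "D * (L * b) \<le> D * (L * norm (w - v j))"
        unfolding D_def using away[OF j] by (intro mult_left_mono) auto
      also have "\<dots> \<le> 2" unfolding D_def by (rule norm_dirichlet_kernel_decay[OF v1 w L])
      finally have "D \<le> 2 / (L * b)" using L b by (simp add: field_simps)
      then have "D\<^sup>2 \<le> (2 / (L * b))\<^sup>2" by (intro power_mono) (simp_all add: D_def)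
      moreover have "norm (poly (\<phi> j) w) \<le> 1 * D\<^sup>2"
        unfolding \<phi>_def D_def poly_mult norm_mult poly_power norm_power
        by (intro mult_right_mono norm_dirichlet_kernel_le_1[OF v1 w]) auto
      ultimately show ?thesis
        unfolding norm_mult using aM[OF j] M0 by (intro mult_mono) auto
    qed
    then have "norm (poly F w) \<le> (\<Sum>j<V. M * (2 / (L * b))\<^sup>2)"
      unfolding F by (intro order_trans[OF norm_sum] sum_mono) auto
    also have "\<dots> = M * (V * (2 / (L * b))\<^sup>2)" by simp
    also have "\<dots> < M * 1" using decay M0 by (intro mult_strict_left_mono)
    finally show ?thesis by simp
  qed
  have "\<exists>p\<in>sphere 0 1. \<forall>w\<in>sphere 0 1. norm (poly F w) \<le> norm (poly F p)"
    by (intro continuous_attains_sup continuous_intros) auto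
  then
  obtain p where p: "norm p = 1" "\<And>w. norm w = 1 \<Longrightarrow> norm (poly F w) \<le> norm (poly F p)"
    by auto
  have pM: "norm (poly F p) \<ge> M" using p(2)[OF v1[of k]] Fk by simp
  obtain j where j: "j < V" "norm (p - v j) < b" using far[OF p(1)] pM by force
  define \<mu> where "\<mu> = norm (poly F p)"
  have \<mu>: "\<mu> > 0" using pM M0 unfolding \<mu>_def by linarith
  show thesis
  proof (rule that[of "smult (of_real (inverse \<mu>)) F" p j])
    have "degree (\<phi> j) \<le> P - 1 + 2 * (L - 1)" for j
      unfolding \<phi>_def using degree_dirichlet_kernel[of P "v j"] degree_dirichlet_kernel[of L "v j"]
      by (intro order_trans[OF degree_mult_le] add_mono order_trans[OF degree_power_le]) auto
    then show "degree (smult (of_real (inverse \<mu>)) F) \<le> P - 1 + 2 * (L - 1)"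
      unfolding F_def
      by (intro order_trans[OF degree_smult_le] degree_sum_le order_trans[OF degree_smult_le]) auto
    show "norm (poly (smult (of_real (inverse \<mu>)) F) w) \<le> 1" if "norm w = 1" for w
      using p(2)[OF that] \<mu> by (simp add: norm_mult norm_divide \<mu>_def[symmetric] field_simps)
    show "norm (poly (smult (of_real (inverse \<mu>)) F) p) = 1"
      using \<mu> by (simp add: norm_mult norm_divide norm_inverse \<mu>_def[symmetric])
    show "poly (smult (of_real (inverse \<mu>)) F) w = 0" if "w \<in> W" for w
      using a(2) that by (simp add: F)
  qed (use p j in \<open>auto simp: v_def\<close>)
qed

lemma arc_between_I: "x < t \<Longrightarrow> t < y \<Longrightarrow> cis t \<in> arc_between x y"
  by (auto simp: arc_between_def)

lemma MZ_imp_count: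
  assumes tri: "triangular_family m z" and MZ: "MZ_family_Linf m z"
  obtains c R1 where "c > 1 / (2 * pi)" "R1 > 0"
    "\<And>R. R \<ge> R1 \<Longrightarrow> \<exists>n0. \<forall>n\<ge>n0. \<forall>x. c * R \<le> card (generation m z n \<inter> arc_between x (x + R / n))"
proof -
  obtain C where C: "C > 0" "\<forall>n\<ge>1. \<forall>q :: complex poly. degree q \<le> n \<longrightarrow>
        (SUP w\<in>sphere 0 1. norm (poly q w)) \<le> C * (SUP j\<in>{..m n}. norm (poly q (z n j)))"
    using MZ unfolding MZ_family_Linf_def by blast
  obtain T \<eta> N0 where T: "T > 0" and \<eta>: "\<eta> > 0" and local:
    "\<And>n (Z :: complex set) a f. real n \<ge> N0 \<Longrightarrow> Z \<subseteq> sphere 0 1 \<Longrightarrow>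
      (\<And>q B. degree q \<le> n \<Longrightarrow> (\<And>w. w \<in> Z \<Longrightarrow> norm (poly q w) \<le> B) \<Longrightarrow> norm (poly q a) \<le> C * B) \<Longrightarrow>
      real (degree f) \<le> (1 + \<eta>) * n \<Longrightarrow> (\<And>w. norm w = 1 \<Longrightarrow> norm (poly f w) \<le> 1) \<Longrightarrow>
      norm a = 1 \<Longrightarrow> norm (poly f a) = 1 \<Longrightarrow>
      \<exists>w\<in>Z. n * norm (w - a) \<le> T \<and> poly f w \<noteq> 0"
    using local_sampling[OF C(1)] by blast
  define c where "c = (1 + \<eta> / 4) / (2 * pi)"
  \<comment> \<open>Solves
    \<open>(1 - 4 * \<kappa>) * (1 + 3 * \<eta> / 8) = 1 + \<eta> / 4\<close>: on a grid with at
    least \<open>(1 + 3 * \<eta> / 8) * n\<close> points per turn, \<open>c * R\<close> steps then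
    fit into the arc with a margin of \<open>2 * \<kappa> * R / n\<close> at both ends.\<close>
  define \<kappa> where "\<kappa> = \<eta> / (32 + 12 * \<eta>)"
  have \<kappa>0: "\<kappa> > 0" using \<eta> by (simp add: \<kappa>_def)
  have c0: "c > 0" using \<eta> by (simp add: c_def)
  \<comment> \<open>The second summand makes \<open>T\<close> at most
    \<open>\<kappa> * R / 4\<close>, the third one yields \<open>decay\<close>.\<close>
  define R1 where "R1 = 1 + 4 * T / \<kappa> + (c + 1) * (32 / (\<eta> * \<kappa>))\<^sup>2"
  show thesis
  proof (rule that[of c R1])
    show "c > 1 / (2 * pi)" using \<eta> by (simp add: c_def divide_strict_right_mono)
    show "R1 > 0" using T \<kappa>0 c0 by (simp add: R1_def add_pos_nonneg)
    fix R assume R: "R \<ge> R1"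
    have "4 * T / \<kappa> \<ge> 0" "(c + 1) * (32 / (\<eta> * \<kappa>))\<^sup>2 \<ge> 0" using T \<kappa>0 c0 by auto
    with R have R_ge: "R \<ge> 1" "4 * T / \<kappa> \<le> R" "(c + 1) * (32 / (\<eta> * \<kappa>))\<^sup>2 < R"
      unfolding R1_def by linarith+
    then have TR: "T \<le> \<kappa> * R / 4" using \<kappa>0 by (simp add: field_simps)
    \<comment> \<open>\<open>8 / \<eta>\<close> limits the loss from rounding \<open>P\<close> down
      to \<open>\<eta> * n / 8\<close>; \<open>R\<close> keeps the arc shorter than a full turn,
      which gives \<open>VP\<close>.\<close>
    define n0 where "n0 = nat \<lceil>max (max N0 1) (max (8 / \<eta>) R)\<rceil>"
    show "\<exists>n0. \<forall>n\<ge>n0. \<forall>x. c * R \<le> card (generation m z n \<inter> arc_between x (x + R / n))"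
    proof (intro exI[of _ n0] allI impI, rule ccontr)
      fix n x assume "n \<ge> n0"
      then have "max (max N0 1) (max (8 / \<eta>) R) \<le> real n"
        unfolding n0_def by (simp add: nat_le_iff ceiling_le_iff)
      then have n: "N0 \<le> real n" "1 \<le> real n" "8 / \<eta> \<le> real n" "R \<le> real n" by auto
      define W where "W = generation m z n \<inter> arc_between x (x + R / n)"
      assume "\<not> c * R \<le> card W"
      then have few: "card W < c * R" by simp
      define V where "V = nat \<lceil>c * R\<rceil>"
      \<comment> \<open>The surplus degree \<open>\<eta> * n\<close> is split evenly between the
        grid kernel of order \<open>P\<close> and the square of the kernel of order
        \<open>L\<close>.\<close>
      define P where "P = nat \<lfloor>(1 + \<eta> / 2) * n\<rfloor>"
      define L where "L = nat \<lfloor>\<eta> * n / 4\<rfloor> + 1"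
      have fin: "finite W" by (simp add: W_def generation_def)
      have V: "c * R \<le> V" "V < c * R + 1"
        unfolding V_def using c0 R_ge real_nat_ceiling_less[of "c * R"] by (simp_all add: real_nat_ceiling_ge)
      have P: "P \<le> (1 + \<eta> / 2) * n" "(1 + \<eta> / 2) * n - 1 < P"
        using real_nat_floor_bounds[of "(1 + \<eta> / 2) * n"] \<eta> by (simp_all add: P_def)
      have "0 \<le> \<eta> * n / 4" using \<eta> by simp
      note fl = real_nat_floor_bounds[OF this]
      have L: "real L - 1 \<le> \<eta> * n / 4" "\<eta> * n / 4 \<le> L" "L > 0"
        unfolding L_def of_nat_add of_nat_1 using fl by linarith+
      have "8 \<le> \<eta> * n" using n(3) \<eta> by (simp add: field_simps)
      with P have P': "(1 + 3 * \<eta> / 8) * n \<le> P" by (simp add: algebra_simps)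
      have "0 < (1 + 3 * \<eta> / 8) * n" using \<eta> n(2) by (intro mult_pos_pos) auto
      with P' have P0: "real P > 0" by linarith
      have span: "2 * pi * (c * R) / P \<le> (1 - 4 * \<kappa>) * R / n"
      proof -
        have "2 * pi * (c * R) / P = (1 + \<eta> / 4) * R / P" by (simp add: c_def)
        also have "\<dots> \<le> (1 + \<eta> / 4) * R / ((1 + 3 * \<eta> / 8) * n)"
          using P' P0 n \<eta> R_ge by (intro divide_left_mono mult_pos_pos) auto
        also have "1 + \<eta> / 4 = (1 - 4 * \<kappa>) * (1 + 3 * \<eta> / 8)"
          using \<eta> by (simp add: \<kappa>_def divide_simps) (simp add: algebra_simps)
        also have "(1 - 4 * \<kappa>) * (1 + 3 * \<eta> / 8) * R / ((1 + 3 * \<eta> / 8) * n) = (1 - 4 * \<kappa>) * R / n"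
          using \<eta> n by (simp add: divide_simps)
        finally show ?thesis .
      qed
      have node: "2 * pi * j / P \<le> (1 - 4 * \<kappa>) * R / n" if "j < V" for j
      proof -
        have "j \<le> c * R" using that V(2) by linarith
        then have "2 * pi * j / P \<le> 2 * pi * (c * R) / P"
          by (intro divide_right_mono mult_left_mono) auto
        then show ?thesis using span by linarith
      qed
      have VP: "V \<le> P"
      proof (rule ccontr)
        assume "\<not> V \<le> P"
        from node[of P] this have "2 * pi \<le> (1 - 4 * \<kappa>) * R / n" using P0 by simp
        also have "\<dots> \<le> 1 * R / n" using \<kappa>0 R_ge by (intro divide_right_mono mult_right_mono) auto
        also have "\<dots> \<le> 1" using n by simp
        finally show False using pi_gt3 by simp
      qed
      \<comment> \<open>A quarter of \<open>\<kappa> * R / n\<close>: one \<open>b\<close> for the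
        distance from the node to the maximum, one for the sampling radius \<open>T / n\<close>, and
        a factor 2 for passing from chords to angles.\<close>
      define b where "b = \<kappa> * R / (4 * n)"
      have b0: "b > 0" using \<kappa>0 R_ge n by (simp add: b_def)
      have "2 / (L * b) \<le> 32 / (\<eta> * \<kappa>) / R"
      proof -
        have "\<eta> * n / 4 * b \<le> L * b" using L b0 by (intro mult_right_mono) auto
        moreover have "\<eta> * n / 4 * b = \<eta> * \<kappa> * R / 16" using n by (simp add: b_def)
        ultimately have "\<eta> * \<kappa> * R / 16 \<le> L * b" by linarith
        moreover have "0 < L * b" "0 < \<eta> * \<kappa> * R / 16" using \<eta> \<kappa>0 R_ge b0 L(3) by simp_all
        ultimately have "2 / (L * b) \<le> 2 / (\<eta> * \<kappa> * R / 16)"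
          by (intro divide_left_mono) (auto intro: mult_pos_pos simp del: zero_less_mult_iff)
        then show ?thesis by (simp add: mult_ac)
      qed
      then have "(2 / (L * b))\<^sup>2 \<le> (32 / (\<eta> * \<kappa>) / R)\<^sup>2" using b0 by (intro power_mono) auto
      moreover have "real V \<le> (c + 1) * R" using V(2) R_ge by (simp add: algebra_simps)
      ultimately have "V * (2 / (L * b))\<^sup>2 \<le> (c + 1) * R * (32 / (\<eta> * \<kappa>) / R)\<^sup>2"
        using c0 R_ge by (intro mult_mono) auto
      also have "\<dots> = (c + 1) * (32 / (\<eta> * \<kappa>))\<^sup>2 / R"
        using R_ge by (simp add: power_divide power2_eq_square)
      also have "\<dots> < 1" using R_ge by simp
      finally have decay: "V * (2 / (L * b))\<^sup>2 < 1" .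
      have card_W: "card W < V" using few V(1) by linarith
      obtain f a j where f: "degree f \<le> P - 1 + 2 * (L - 1)" "\<And>w. norm w = 1 \<Longrightarrow> norm (poly f w) \<le> 1"
        "norm a = 1" "norm (poly f a) = 1" "j < V"
        "norm (a - cis (x + 2 * \<kappa> * R / n + 2 * pi * j / P)) < b"
        "\<And>w. w \<in> W \<Longrightarrow> poly f w = 0"
        using exists_localized_vanishing_poly[OF fin card_W VP L(3) b0 decay, of "x + 2 * \<kappa> * R / n"]
        by blast
      have "real (degree f) \<le> real P + 2 * (real L - 1)"
        using f(1) L(3) by (simp add: of_nat_diff)
      then have deg: "real (degree f) \<le> (1 + \<eta>) * n"
        using P L(1,3) by (simp add: algebra_simps of_nat_diff)
      have sub: "generation m z n \<subseteq> sphere 0 1"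
        using tri by (auto simp: triangular_family_def generation_def)
      have samp: "norm (poly q a) \<le> C * B"
        if "degree q \<le> n" "\<And>w. w \<in> generation m z n \<Longrightarrow> norm (poly q w) \<le> B" for q B
        using n(2) by (intro MZ_sampling[OF _ C(2,1) that f(3)]) auto
      obtain w where w: "w \<in> generation m z n" "n * norm (w - a) \<le> T" "poly f w \<noteq> 0"
        using local[OF n(1) sub samp deg f(2) f(3,4)] by blast
      define \<theta> where "\<theta> = x + 2 * \<kappa> * R / n + 2 * pi * j / P"
      have w1: "norm w = 1" using w(1) sub by auto
      obtain t where t: "w = cis \<theta> * cis t" "\<bar>t\<bar> \<le> 2 * norm (w - cis \<theta>)"
        using unit_circle_close_cis[OF w1, of "cis \<theta>"] by auto
      have "norm (w - a) \<le> b"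
      proof -
        have "norm (w - a) \<le> T / n" using w(2) n(2) by (simp add: field_simps)
        also have "\<dots> \<le> (\<kappa> * R / 4) / n" using TR by (intro divide_right_mono) auto
        finally show ?thesis by (simp add: b_def)
      qed
      moreover have "norm (w - cis \<theta>) \<le> norm (w - a) + norm (a - cis \<theta>)"
        using norm_triangle_ineq[of "w - a" "a - cis \<theta>"] by simp
      ultimately have "norm (w - cis \<theta>) < 2 * b" using f(6) by (simp add: \<theta>_def)
      with t(2) have "\<bar>t\<bar> < 4 * b" by linarith
      also have "4 * b = \<kappa> * R / n" by (simp add: b_def)
      finally have t_less: "\<bar>t\<bar> < \<kappa> * R / n" .
      have pos: "0 < \<kappa> * R / n" using \<kappa>0 R_ge n by simp
      have "x < \<theta> + t" "\<theta> + t < x + R / n"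
      proof -
        have "2 * pi * j / P \<ge> 0" by simp
        then show "x < \<theta> + t" using t_less pos unfolding \<theta>_def by (simp; linarith)
        have "(1 - 4 * \<kappa>) * R / n = R / n - 4 * (\<kappa> * R / n)"
          by (simp add: diff_divide_distrib left_diff_distrib)
        then show "\<theta> + t < x + R / n" using node[OF f(5)] t_less pos unfolding \<theta>_def by (simp; linarith)
      qed
      then have "w \<in> W" using w(1) t(1) arc_between_I[of x "\<theta> + t" "x + R / n"]
        by (simp add: W_def cis_mult)
      with f(7) w(3) show False by blast
    qed
  qed
qed

section \<open>Jensen's formula for functions of exponential type\<close>

lemma arctan_le_self:
  assumes "0 \<le> (x::real)"
  shows "arctan x \<le> x"
proof -
  have a: "0 \<le> arctan x" "- (pi / 2) < arctan x" "arctan x < pi / 2"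
    using assms arctan_bounded[of x] by auto
  then have "arctan x * cos (arctan x) \<le> sin (arctan x)" by (intro mult_cos_le_sin) auto
  moreover have "cos (arctan x) > 0" using a by (intro cos_gt_zero_pi) auto
  ultimately have "arctan x \<le> tan (arctan x)" by (simp add: tan_def field_simps)
  moreover have "tan (arctan x) = x" using arctan[of x] by blast
  ultimately show ?thesis by linarith
qed

text \<open>Both sides are even, and for positive \<open>y\<close> the gap between
  \<open>arctan y\<close> and pi / 2 is \<open>arctan (1 / y)\<close>, at most
  \<open>1 / y\<close>.\<close>

lemma mult_arctan_ge:
  fixes y :: real
  shows "y * arctan y \<ge> \<bar>y\<bar> * pi / 2 - 1"
proof -
  have pos: "y * arctan y \<ge> y * pi / 2 - 1" if "y > 0" for y :: real
  proof -
    have "arctan (1 / y) = pi / 2 - arctan y" using arctan_inverse[of y] that by (simp add: inverse_eq_divide)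
    moreover have "arctan (1 / y) \<le> 1 / y" using that by (intro arctan_le_self) auto
    ultimately have "y * (pi / 2 - 1 / y) \<le> y * arctan y" using that by (intro mult_left_mono) auto
    then show ?thesis using that by (simp add: right_diff_distrib)
  qed
  consider "y > 0" | "y = 0" | "y < 0" by linarith
  then show ?thesis
    using pos[of y] pos[of "-y"] by cases (auto simp: arctan_minus)
qed

lemma Im_Ln_eq_arctan:
  assumes "Re z > 0"
  shows "Im (Ln z) = arctan (Im z / Re z)"
proof -
  have "z \<noteq> 0" using assms by auto
  then have z: "z = exp (Ln z)" by simp
  have "tan (Im (Ln z)) = Im z / Re z"
    by (subst (2 3) z) (simp add: Re_exp Im_exp tan_def)
  then show ?thesis using Re_Ln_pos_lt_imp[OF assms] by (intro arctan_unique[symmetric]) auto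
qed

text \<open>The function \<open>(2 / pi) (1 / z - z) artanh (\<rho> z)\<close> has on the unit circle the real part
  \<open>(2 / pi) s arctan (2 \<rho> s / (1 - \<rho>\<^sup>2))\<close> with \<open>s = Im z\<close>; letting \<open>\<rho>\<close> tend to 1 it approximates
  the Poisson extension of \<open>\<bar>s\<bar>\<close>, which has the value \<open>2 / pi\<close> at the centre.\<close>

lemma abs_Im_holomorphic_minorant:
  fixes e :: real
  assumes "e > 0"
  obtains H q where "q > 1" "H holomorphic_on ball 0 q" "Re (H 0) \<le> 2 / pi"
    "\<And>z. norm z = 1 \<Longrightarrow> \<bar>Im z\<bar> - e \<le> Re (H z)"
proof -
  \<comment> \<open>The final error \<open>2 / (pi * \<kappa>)\<close> is \<open>1 - \<rho>\<close>
    times a factor that is at most 2 as soon as \<open>\<rho>\<close> is at least 1/2.\<close>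
  define \<rho> where "\<rho> = max (1 / 2) (1 - e / 2)"
  have \<rho>: "1 / 2 \<le> \<rho>" "\<rho> < 1" "1 - \<rho> \<le> e / 2" using assms by (simp_all add: \<rho>_def max_def)
  define \<kappa> where "\<kappa> = 2 * \<rho> / (1 - \<rho>\<^sup>2)"
  have sq: "1 - \<rho>\<^sup>2 = (1 - \<rho>) * (1 + \<rho>)" by (simp add: power2_eq_square algebra_simps)
  have sq0: "1 - \<rho>\<^sup>2 > 0" unfolding sq using \<rho> by simp
  have \<kappa>0: "\<kappa> > 0" using \<rho> sq0 by (simp add: \<kappa>_def)
  have \<kappa>e: "2 / (pi * \<kappa>) \<le> e"
  proof -
    have "2 / (pi * \<kappa>) = (1 - \<rho>) * ((1 + \<rho>) / (pi * \<rho>))" using \<rho> sq0 by (simp add: \<kappa>_def sq)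
    also have "(1 + \<rho>) / (pi * \<rho>) \<le> 2"
    proof -
      have "1 + \<rho> \<le> 2 * (3 * \<rho>)" using \<rho> by simp
      also have "\<dots> \<le> 2 * (pi * \<rho>)" using \<rho> pi_gt3 by (intro mult_left_mono mult_right_mono) auto
      finally show ?thesis using \<rho> by (simp add: divide_simps)
    qed
    then have "(1 - \<rho>) * ((1 + \<rho>) / (pi * \<rho>)) \<le> (1 - \<rho>) * 2" using \<rho> by (intro mult_left_mono) auto
    also have "\<dots> \<le> e" using \<rho> by simp
    finally show ?thesis by simp
  qed
  \<comment> \<open>Half the logarithm of this Cayley transform is artanh (rho z). It sends the disc
    of radius \<open>1 / \<rho>\<close> into the right half-plane, where \<open>Ln\<close> is
    holomorphic.\<close>
  define u where "u z = (1 + of_real \<rho> * z) / (1 - of_real \<rho> * z)" for z :: complex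
  define q where "q = 1 / \<rho>"
  have norm_less: "norm (of_real \<rho> * z) < 1" if "z \<in> ball 0 q" for z :: complex
    using that \<rho> by (simp add: q_def norm_mult field_simps)
  have ne: "1 - of_real \<rho> * z \<noteq> 0" if "z \<in> ball 0 q" for z :: complex
    using norm_less[OF that] by auto
  have u_expand: "Re (u z) = (1 - (norm (of_real \<rho> * z))\<^sup>2) / (norm (1 - of_real \<rho> * z))\<^sup>2"
    "Im (u z) = 2 * \<rho> * Im z / (norm (1 - of_real \<rho> * z))\<^sup>2" for z
    unfolding u_def cmod_power2 by (simp_all add: Re_divide Im_divide power2_eq_square algebra_simps)
  have u_pos: "Re (u z) > 0" if "z \<in> ball 0 q" for z :: complex
  proof -
    have "(norm (of_real \<rho> * z))\<^sup>2 < 1" using norm_less[OF that] by (simp add: power_less_one_iff abs_square_less_1)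
    then show ?thesis using ne[OF that] by (simp add: u_expand)
  qed
  define A where "A z = Ln (u z) / 2" for z
  have u_slit: "u z \<notin> \<real>\<^sub>\<le>\<^sub>0" if "z \<in> ball 0 q" for z
    using u_pos[OF that] by (auto simp: complex_nonpos_Reals_iff)
  have A_hol: "A holomorphic_on ball 0 q"
    unfolding A_def u_def
    by (intro holomorphic_intros) (fact u_slit[unfolded u_def] ne | simp)+
  have A0: "A 0 = 0" by (simp add: A_def u_def)
  have "(A has_field_derivative of_real \<rho>) (at 0)"
    unfolding A_def u_def by (auto intro!: derivative_eq_intros simp: complex_nonpos_Reals_iff)
  then have dA: "deriv A 0 = of_real \<rho>" by (rule DERIV_imp_deriv)
  \<comment> \<open>This is \<open>A z / z\<close> with the removable singularity filled in, which
    takes care of the pole of 1 / z - z.\<close>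
  define F where "F z = (if z = 0 then deriv A 0 else (A z - A 0) / (z - 0))" for z
  have q1: "q > 1" using \<rho> by (simp add: q_def)
  have F_hol: "F holomorphic_on ball 0 q"
    unfolding F_def using q1 by (intro pole_lemma A_hol) auto
  define H where "H z = of_real (2 / pi) * (1 - z\<^sup>2) * F z" for z
  show thesis
  proof (rule that[of q H])
    show "H holomorphic_on ball 0 q" unfolding H_def by (intro holomorphic_intros F_hol)
    show "Re (H 0) \<le> 2 / pi" using \<rho> by (simp add: H_def F_def dA divide_right_mono)
    fix z :: complex assume z: "norm z = 1"
    have z0: "z \<noteq> 0" "z \<in> ball 0 q" using z q1 by auto
    have "(1 - z\<^sup>2) / z = cnj z - z"
      using z z0 complex_norm_square[of z] by (simp add: field_simps power2_eq_square)
    also have "\<dots> = - 2 * \<i> * of_real (Im z)" by (simp add: complex_eq_iff)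
    finally have slope: "(1 - z\<^sup>2) / z = - 2 * \<i> * of_real (Im z)" .
    have "F z = A z / z" using z0 A0 by (simp add: F_def)
    then have "H z = of_real (2 / pi) * ((1 - z\<^sup>2) / z) * A z" by (simp add: H_def)
    then have "H z = of_real (2 / pi) * (- \<i> * of_real (Im z)) * Ln (u z)"
      unfolding slope A_def by simp
    then have "Re (H z) = 2 / pi * (Im z * Im (Ln (u z)))" by simp
    also have "Im (Ln (u z)) = arctan (Im (u z) / Re (u z))"
      using u_pos[OF z0(2)] by (rule Im_Ln_eq_arctan)
    also have "Im (u z) / Re (u z) = \<kappa> * Im z"
      using ne[OF z0(2)] z \<rho> by (simp add: u_expand \<kappa>_def norm_mult)
    also have "2 / pi * (Im z * arctan (\<kappa> * Im z)) = 2 / (pi * \<kappa>) * (\<kappa> * Im z * arctan (\<kappa> * Im z))"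
      using \<kappa>0 by simp
    finally have "Re (H z) = \<dots>" .
    also have "\<dots> \<ge> 2 / (pi * \<kappa>) * (\<bar>\<kappa> * Im z\<bar> * pi / 2 - 1)"
      using \<kappa>0 by (intro mult_left_mono mult_arctan_ge) auto
    also have "2 / (pi * \<kappa>) * (\<bar>\<kappa> * Im z\<bar> * pi / 2 - 1) = \<bar>Im z\<bar> - 2 / (pi * \<kappa>)"
      using \<kappa>0 by (simp add: abs_mult right_diff_distrib)
    finally show "\<bar>Im z\<bar> - e \<le> Re (H z)" using \<kappa>e by linarith
  qed (rule q1)
qed

lemma holomorphic_divide_zeros:
  fixes g :: "complex \<Rightarrow> complex"
  assumes "finite X" "g holomorphic_on UNIV" "\<And>x. x \<in> X \<Longrightarrow> g x = 0"
  shows "\<exists>h. h holomorphic_on UNIV \<and> (\<forall>t. g t = (\<Prod>x\<in>X. t - x) * h t)"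
  using assms
proof (induction X rule: finite_induct)
  case empty
  then show ?case by (intro exI[of _ g]) auto
next
  case (insert a X)
  then obtain h where h: "h holomorphic_on UNIV" "\<And>t. g t = (\<Prod>x\<in>X. t - x) * h t" by auto
  have "(\<Prod>x\<in>X. a - x) \<noteq> 0" using insert.hyps by auto
  then have ha: "h a = 0" using h(2)[of a] insert.prems by auto
  define k where "k t = (if t = a then deriv h a else (h t - h a) / (t - a))" for t
  have "k holomorphic_on UNIV" unfolding k_def by (intro pole_lemma h(1)) auto
  moreover have "h t = (t - a) * k t" for t using ha by (simp add: k_def)
  then have "g t = (\<Prod>x\<in>insert a X. t - x) * k t" for t
    using insert.hyps h(2)[of t] by simp
  ultimately show ?case by blast
qed

text \<open>Jensen's inequality without logarithmic integrals. The zeros are replaced by the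
  reflected factors \<open>b x\<close>, of equal modulus on the circle of radius \<open>r\<close>,
  and a factor with \<open>H\<close> in the exponent cancels the growth there up to
  \<open>exp (\<tau> * r * e)\<close>. The maximum principle then compares with the value at
  0.\<close>

lemma jensen_exponential_type:
  fixes g :: "complex \<Rightarrow> complex" and X :: "real set"
  assumes g: "g holomorphic_on UNIV" and X: "finite X" "\<And>x. x \<in> X \<Longrightarrow> 0 < \<bar>x\<bar> \<and> \<bar>x\<bar> < r"
    and zero: "\<And>x. x \<in> X \<Longrightarrow> g (of_real x) = 0" and r: "r > 0" and \<tau>: "\<tau> \<ge> 0"
    and bound: "\<And>t. norm t = r \<Longrightarrow> norm (g t) \<le> M * exp (\<tau> * \<bar>Im t\<bar>)" and e: "e > 0"
  shows "norm (g 0) * (\<Prod>x\<in>X. r / \<bar>x\<bar>) \<le> M * exp (\<tau> * r * (2 / pi + e))"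
proof -
  obtain H q where H: "q > 1" "H holomorphic_on ball 0 q" "Re (H 0) \<le> 2 / pi"
    "\<And>z. norm z = 1 \<Longrightarrow> \<bar>Im z\<bar> - e \<le> Re (H z)"
    using abs_Im_holomorphic_minorant[OF e] by metis
  have "\<exists>h. h holomorphic_on UNIV \<and> (\<forall>t. g t = (\<Prod>x\<in>of_real ` X. t - x) * h t)"
    using X zero by (intro holomorphic_divide_zeros g) auto
  then obtain h where h: "h holomorphic_on UNIV" "\<And>t. g t = (\<Prod>x\<in>X. t - of_real x) * h t"
    by (auto simp: prod.reindex inj_on_def)
  define b where "b x t = of_real r - of_real (x / r) * t" for x :: real and t :: complex
  define G where "G t = h t * (\<Prod>x\<in>X. b x t) * exp (- (of_real (\<tau> * r) * H (t / of_real r)))" for t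
  have sub: "(\<lambda>t. t / of_real r) ` ball 0 (r * q) \<subseteq> ball (0 :: complex) q"
    using r by (auto simp: norm_divide dist_norm field_simps)
  have "(\<lambda>t. t / of_real r) holomorphic_on ball (0 :: complex) (r * q)"
    using r by (intro holomorphic_intros) auto
  then have H': "(\<lambda>t. H (t / of_real r)) holomorphic_on ball 0 (r * q)"
    using holomorphic_on_compose_gen[OF _ H(2) sub] by (simp add: o_def)
  have G_hol: "G holomorphic_on ball 0 (r * q)"
    unfolding G_def b_def
    by (intro holomorphic_intros H') (use h(1) holomorphic_on_subset in blast)
  have "r < r * q" using H(1) r by simp
  then have disc: "cball 0 r \<subseteq> ball (0::complex) (r * q)" by auto
  have "norm (G 0) \<le> M * exp (\<tau> * r * e)"
  proof (rule maximum_modulus_frontier[of G "cball 0 r"])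
    show "G holomorphic_on interior (cball 0 r)"
      by (rule holomorphic_on_subset[OF G_hol]) (use disc in auto)
    show "continuous_on (closure (cball 0 r)) G"
      using holomorphic_on_imp_continuous_on[OF G_hol] disc by (auto intro: continuous_on_subset)
    fix t :: complex assume "t \<in> frontier (cball 0 r)"
    then have t: "norm t = r" using r by auto
    have "norm (b x t) = norm (t - of_real x)" for x
    proof -
      have "b x t = t / of_real r * cnj (t - of_real x)"
        using r t complex_norm_square[of t] by (simp add: b_def field_simps power2_eq_square)
      then show ?thesis using t r by (simp only: norm_mult complex_mod_cnj norm_divide) simp
    qed
    then have "norm (G t) = norm (g t) * exp (- (\<tau> * r * Re (H (t / of_real r))))"
      unfolding G_def h(2) norm_mult prod_norm[symmetric] norm_exp_eq_Re by simp
    also have "\<dots> \<le> M * exp (\<tau> * \<bar>Im t\<bar>) * exp (\<tau> * r * e - \<tau> * \<bar>Im t\<bar>)"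
    proof (intro mult_mono bound[OF t])
      have "\<bar>Im (t / of_real r)\<bar> - e \<le> Re (H (t / of_real r))"
        using t r by (intro H(4)) (simp add: norm_divide)
      then have "\<tau> * r * (\<bar>Im (t / of_real r)\<bar> - e) \<le> \<tau> * r * Re (H (t / of_real r))"
        using \<tau> r by (intro mult_left_mono) auto
      moreover have "\<tau> * r * (\<bar>Im (t / of_real r)\<bar> - e) = \<tau> * \<bar>Im t\<bar> - \<tau> * r * e"
        using r by (simp add: right_diff_distrib)
      ultimately show "exp (- (\<tau> * r * Re (H (t / of_real r)))) \<le> exp (\<tau> * r * e - \<tau> * \<bar>Im t\<bar>)" by simp
      show "0 \<le> M * exp (\<tau> * \<bar>Im t\<bar>)" using bound[OF t] norm_ge_zero order_trans by blast
    qed simp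
    also have "\<dots> = M * exp (\<tau> * r * e)" by (simp add: mult_exp_exp mult.assoc)
    finally show "norm (G t) \<le> M * exp (\<tau> * r * e)" .
  qed (use r in auto)
  moreover have "norm (g 0) * (\<Prod>x\<in>X. r / \<bar>x\<bar>) * exp (- (\<tau> * r * (2 / pi))) \<le> norm (G 0)"
  proof -
    have "(\<Prod>x\<in>X. \<bar>x\<bar>) * (\<Prod>x\<in>X. r / \<bar>x\<bar>) = (\<Prod>x\<in>X. r)"
      unfolding prod.distrib[symmetric] using X by (intro prod.cong) auto
    then have "norm (g 0) * (\<Prod>x\<in>X. r / \<bar>x\<bar>) = norm (h 0) * (\<Prod>x\<in>X. r)"
      by (simp add: h(2)[of 0] norm_mult prod_norm[symmetric] mult_ac)
    moreover have "norm (G 0) = norm (h 0) * (\<Prod>x\<in>X. r) * exp (- (\<tau> * r * Re (H 0)))"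
      using r by (simp add: G_def b_def norm_mult prod_norm[symmetric] norm_power)
    moreover have "\<tau> * r * Re (H 0) \<le> \<tau> * r * (2 / pi)" using H(3) \<tau> r by (intro mult_left_mono) auto
    ultimately show ?thesis using r by (auto intro!: mult_left_mono)
  qed
  ultimately have "norm (g 0) * (\<Prod>x\<in>X. r / \<bar>x\<bar>) * exp (- (\<tau> * r * (2 / pi))) \<le> M * exp (\<tau> * r * e)"
    by linarith
  then have "norm (g 0) * (\<Prod>x\<in>X. r / \<bar>x\<bar>) \<le> M * exp (\<tau> * r * e) / exp (- (\<tau> * r * (2 / pi)))"
    by (simp add: pos_le_divide_eq)
  also have "\<dots> = M * exp (\<tau> * r * (2 / pi + e))"
    by (simp add: exp_minus field_simps exp_add[symmetric])
  finally show ?thesis .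
qed

text \<open>A crude factorwise estimate, but it depends only on the number of nodes,
  \<open>\<sigma>\<close>, \<open>R\<close> and \<open>\<delta>\<close>; for the rescaled sampling
  points it is therefore uniform in the degree.\<close>

lemma lagrange_interpolation_bound:
  fixes X :: "complex set" and v :: "complex \<Rightarrow> complex"
  assumes X: "finite X" "\<And>x y. x \<in> X \<Longrightarrow> y \<in> X \<Longrightarrow> x \<noteq> y \<Longrightarrow> norm (x - y) \<ge> \<sigma>"
    "\<And>x. x \<in> X \<Longrightarrow> norm x \<le> R" and \<sigma>: "\<sigma> > 0"
    and v: "\<And>x. x \<in> X \<Longrightarrow> norm (v x) \<le> \<delta>"
  obtains p where "degree p \<le> card X - 1" "\<And>x. x \<in> X \<Longrightarrow> poly p x = v x"
    "\<And>t. norm t \<le> R \<Longrightarrow> norm (poly p t) \<le> card X * (\<delta> * max 1 (2 * R / \<sigma>) ^ card X)"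
proof -
  define l where "l x = (\<Prod>y\<in>X - {x}. smult (inverse (x - y)) [:-y, 1:])" for x
  have l: "poly (l x) t = (\<Prod>y\<in>X - {x}. (t - y) / (x - y))" for x t
    unfolding l_def poly_prod by (intro prod.cong) (simp_all add: divide_inverse left_diff_distrib)
  have l_node: "poly (l x) y = (if y = x then 1 else 0)" if "x \<in> X" "y \<in> X" for x y
  proof (cases "y = x")
    case False
    have "(\<Prod>w\<in>X - {x}. (y - w) / (x - w)) = 0"
      using that False X(1) by (intro prod_zero) auto
    with False show ?thesis by (simp add: l)
  next
    case True
    have "(\<Prod>w\<in>X - {x}. (x - w) / (x - w)) = 1" by (intro prod.neutral) auto
    then show ?thesis unfolding l True by (simp only: if_True refl)
  qed
  define K where "K = max 1 (2 * R / \<sigma>)"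
  have K1: "K \<ge> 1" by (simp add: K_def)
  define p where "p = (\<Sum>x\<in>X. smult (v x) (l x))"
  show thesis
  proof (rule that[of p])
    have "degree (l x) \<le> card X - 1" if "x \<in> X" for x
    proof -
      have "degree (l x) \<le> (\<Sum>y\<in>X - {x}. degree (smult (inverse (x - y)) [:-y, 1:]))"
        unfolding l_def by (rule order_trans[OF degree_prod_sum_le]) (use X in \<open>auto simp: o_def\<close>)
      also have "\<dots> \<le> (\<Sum>y\<in>X - {x}. 1)"
        by (intro sum_mono order_trans[OF degree_smult_le]) simp
      also have "\<dots> = card X - 1" using X(1) that by simp
      finally show ?thesis .
    qed
    then show "degree p \<le> card X - 1"
      unfolding p_def by (intro degree_sum_le X(1)) (auto intro: order_trans[OF degree_smult_le])
    show "poly p x = v x" if "x \<in> X" for x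
    proof -
      have "poly p x = (\<Sum>y\<in>X. if y = x then v y else 0)"
        unfolding p_def poly_sum using that by (intro sum.cong) (auto simp: l_node)
      then show ?thesis using X(1) that by simp
    qed
    fix t :: complex assume t: "norm t \<le> R"
    then have R0: "0 \<le> R" using norm_ge_zero order_trans by blast
    have "norm (poly (l x) t) \<le> K ^ card X" if x: "x \<in> X" for x
    proof -
      have "norm ((t - y) / (x - y)) \<le> K" if y: "y \<in> X - {x}" for y
      proof -
        have "norm (t - y) \<le> 2 * R" using norm_triangle_ineq4[of t y] t X(3)[of y] y by auto
        moreover have "norm (x - y) \<ge> \<sigma>" using X(2) x y by auto
        ultimately have "norm (t - y) / norm (x - y) \<le> 2 * R / \<sigma>"
          using \<sigma> by (intro frac_le) (use R0 in auto)
        then show ?thesis by (simp add: K_def norm_divide)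
      qed
      then have "norm (poly (l x) t) \<le> (\<Prod>y\<in>X - {x}. K)"
        unfolding l prod_norm[symmetric] by (intro prod_mono) auto
      also have "\<dots> = K ^ (card X - 1)" using X(1) x by simp
      also have "\<dots> \<le> K ^ card X" using K1 by (intro power_increasing) auto
      finally show ?thesis .
    qed
    then have "norm (v x * poly (l x) t) \<le> \<delta> * K ^ card X" if "x \<in> X" for x
      unfolding norm_mult using v[OF that] that
      by (intro mult_mono) (auto intro: order_trans[OF norm_ge_zero])
    then have "norm (poly p t) \<le> (\<Sum>x\<in>X. \<delta> * K ^ card X)"
      unfolding p_def poly_sum by (intro order_trans[OF norm_sum] sum_mono) simp
    then show "norm (poly p t) \<le> card X * (\<delta> * max 1 (2 * R / \<sigma>) ^ card X)"
      by (simp add: K_def)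
  qed
qed

section \<open>Sufficiency of the density condition\<close>

text \<open>A Stirling-type bound whose induction step is e \<le> (1 + 1 / a)^(a + 1).\<close>

lemma exp_le_power_div_fact: "exp (real K) \<le> real (Suc K) ^ Suc K / fact (Suc K) * real (Suc K)"
proof (induction K)
  case (Suc K)
  define a where "a = real (Suc K)"
  have a: "a > 0" by (simp add: a_def)
  have "exp 1 \<le> ((a + 1) / a) ^ Suc (Suc K)"
  proof -
    have "ln (a / (a + 1)) \<le> a / (a + 1) - 1" using a by (intro ln_le_minus_one) auto
    also have "\<dots> = - (1 / (a + 1))" using a by (simp add: field_simps)
    finally have "1 / (a + 1) \<le> ln ((a + 1) / a)" using a by (simp add: ln_div)
    then have "1 \<le> s * ln ((a + 1) / a)" if "s = a + 1" for s
      using a that by (simp add: field_simps)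
    from this[of "real (Suc (Suc K))"] have "1 \<le> real (Suc (Suc K)) * ln ((a + 1) / a)"
      by (simp add: a_def)
    moreover have "real (Suc (Suc K)) * ln ((a + 1) / a) = ln (((a + 1) / a) ^ Suc (Suc K))"
      by (rule ln_realpow[symmetric])
    ultimately have "1 \<le> ln (((a + 1) / a) ^ Suc (Suc K))" by (simp only:)
    then show ?thesis using a by (subst (asm) ln_ge_iff) auto
  qed
  moreover have "exp (real K) \<le> a ^ Suc K / fact (Suc K) * a" using Suc.IH by (simp add: a_def)
  ultimately have "exp (real K) * exp 1 \<le> a ^ Suc K / fact (Suc K) * a * ((a + 1) / a) ^ Suc (Suc K)"
    using a by (intro mult_mono) auto
  also have "\<dots> = (a + 1) ^ Suc (Suc K) / fact (Suc K)"
    using a by (simp add: power_divide)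
  also have "\<dots> = (a + 1) ^ Suc (Suc K) / fact (Suc (Suc K)) * (a + 1)"
  proof -
    have fact_eq: "fact (Suc (Suc K)) = (a + 1) * fact (Suc K)" by (simp add: a_def)
    have "x / F = x / ((a + 1) * F) * (a + 1)" for x F :: real using a by simp
    then show ?thesis unfolding fact_eq .
  qed
  finally show ?case by (simp add: a_def exp_add[symmetric] add.commute)
qed simp

text \<open>The product is K^K / K!. It bounds the share of the zeros in Jensen's inequality: a zero
  in the ring with index \<open>j\<close>, out of \<open>K\<close> rings of width \<open>R\<close>,
  has r / |x| at least K / (j + 1).\<close>

lemma prod_scaled_ge_exp:
  assumes "K > 0"
  shows "exp (real K - 1 - ln K) \<le> (\<Prod>j<K. real K / real (Suc j))"
proof -
  obtain k where k: "K = Suc k" using assms by (cases K) auto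
  have "(\<Prod>j<K. real K / real (Suc j)) = real K ^ K / fact K"
    by (simp add: prod_dividef fact_prod_Suc atLeast0LessThan)
  moreover have "exp (real K - 1) \<le> real K ^ K / fact K * K"
    using exp_le_power_div_fact[of k] by (simp add: k)
  moreover have "exp (real K - 1 - ln K) = exp (real K - 1) / K"
    using assms by (simp add: exp_diff[of _ "ln K"])
  ultimately show ?thesis using assms by (simp add: pos_divide_le_eq)
qed

section \<open>Rescaled angles of the sampling points\<close>

lemma norm_cis_diff_le: "norm (cis s - cis t) \<le> \<bar>s - t\<bar>"
proof -
  have "cis s - cis t = cis t * (cis (s - t) - 1)" by (simp add: right_diff_distrib cis_mult)
  then have "norm (cis s - cis t) = norm (cis (s - t) - 1)" by (simp add: norm_mult)
  also have "\<dots> = 2 * \<bar>sin ((s - t) / 2)\<bar>" using dist_exp_i_1[of "s - t"] by (simp add: cis_conv_exp)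
  also have "\<dots> \<le> 2 * \<bar>(s - t) / 2\<bar>" by (intro mult_left_mono abs_sin_x_le_abs_x) auto
  finally show ?thesis by simp
qed

text \<open>Angles are measured from \<open>\<phi>\<close> in units of \<open>1 / n\<close>. Exactly
  \<open>N\<close> of them are kept, so that later all rings have the same number of zeros.\<close>

lemma arc_parameters:
  fixes G :: "complex set" and \<phi> s l n :: real
  assumes "finite G" "n > 0" "N \<le> card (G \<inter> arc_between (\<phi> + s / n) (\<phi> + s / n + l / n))"
  obtains T where "finite T" "card T = N" "\<And>t. t \<in> T \<Longrightarrow> s < t \<and> t < s + l \<and> cis (\<phi> + t / n) \<in> G"
proof -
  define A where "A = G \<inter> arc_between (\<phi> + s / n) (\<phi> + s / n + l / n)"
  obtain S where S: "S \<subseteq> A" "card S = N" "finite S"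
    using obtain_subset_with_card_n[of N A] assms by (auto simp: A_def)
  have "\<exists>t. s < t \<and> t < s + l \<and> cis (\<phi> + t / n) = w" if "w \<in> S" for w
  proof -
    have "w \<in> arc_between (\<phi> + s / n) (\<phi> + s / n + l / n)" using that S(1) by (auto simp: A_def)
    then obtain \<theta> where \<theta>: "\<phi> + s / n < \<theta>" "\<theta> < \<phi> + s / n + l / n" "w = cis \<theta>"
      by (auto simp: arc_between_def)
    then have "s < n * (\<theta> - \<phi>)" "n * (\<theta> - \<phi>) < s + l" "\<phi> + n * (\<theta> - \<phi>) / n = \<theta>"
      using assms(2) by (simp_all add: field_simps)
    then show ?thesis using \<theta>(3) by (intro exI[of _ "n * (\<theta> - \<phi>)"]) simp
  qed
  then obtain t where t: "\<And>w. w \<in> S \<Longrightarrow> s < t w \<and> t w < s + l \<and> cis (\<phi> + t w / n) = w"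
    by metis
  have "inj_on t S" by (rule inj_onI) (metis t)
  show thesis
  proof (rule that[of "t ` S"])
    show "card (t ` S) = N" using \<open>inj_on t S\<close> S by (simp add: card_image)
    show "s < u \<and> u < s + l \<and> cis (\<phi> + u / n) \<in> G" if "u \<in> t ` S" for u
      using that t S(1) by (auto simp: A_def)
  qed (use S in simp)
qed

lemma symmetric_arc_parameters:
  fixes G :: "complex set" and R \<phi> n :: real
  assumes G: "finite G" "n > 0" and count: "\<And>x. N \<le> card (G \<inter> arc_between x (x + R / n))"
    and R: "R > 0"
  obtains Y :: "nat \<Rightarrow> real set" where "\<And>j. finite (Y j)" "\<And>j. card (Y j) = 2 * N"
    "\<And>j t. t \<in> Y j \<Longrightarrow> j * R < \<bar>t\<bar> \<and> \<bar>t\<bar> < Suc j * R \<and> cis (\<phi> + t / n) \<in> G"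
proof -
  have "\<exists>Y. finite Y \<and> card Y = 2 * N \<and> (\<forall>t\<in>Y. j * R < \<bar>t\<bar> \<and> \<bar>t\<bar> < Suc j * R \<and> cis (\<phi> + t / n) \<in> G)"
    for j :: nat
  proof -
    obtain T where T: "finite T" "card T = N"
      "\<And>t. t \<in> T \<Longrightarrow> j * R < t \<and> t < j * R + R \<and> cis (\<phi> + t / n) \<in> G"
      using arc_parameters[OF G, of N \<phi> "j * R" R] count[of "\<phi> + j * R / n"] by metis
    obtain U where U: "finite U" "card U = N"
      "\<And>t. t \<in> U \<Longrightarrow> - (Suc j * R) < t \<and> t < - (Suc j * R) + R \<and> cis (\<phi> + t / n) \<in> G"
      using arc_parameters[OF G, of N \<phi> "- (Suc j * R)" R] count[of "\<phi> + - (Suc j * R) / n"] by metis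
    have jR: "0 \<le> j * R" using R by simp
    have Suc_jR: "Suc j * R = j * R + R" by (simp add: algebra_simps)
    have T': "0 < t" "j * R < t" "t < Suc j * R" if "t \<in> T" for t
      using T(3)[OF that] jR Suc_jR by linarith+
    have U': "t < 0" "j * R < - t" "- t < Suc j * R" if "t \<in> U" for t
      using U(3)[OF that] jR Suc_jR by linarith+
    have "T \<inter> U = {}" using T'(1) U'(1) by fastforce
    then have "card (T \<union> U) = 2 * N" using T U by (simp add: card_Un_disjoint)
    moreover have "j * R < \<bar>t\<bar> \<and> \<bar>t\<bar> < Suc j * R \<and> cis (\<phi> + t / n) \<in> G" if "t \<in> T \<union> U" for t
      using that T' U' T(3) U(3) by (cases "t \<in> T") (auto simp: abs_of_pos abs_of_neg)
    ultimately show ?thesis using T(1) U(1) by (intro exI[of _ "T \<union> U"]) auto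
  qed
  then show thesis using that by metis
qed

text \<open>The exponential factor moves the frequencies from [0, 1] to [-1/2, 1/2], which lowers
  the type from 1 to 1/2.\<close>

lemma norm_poly_exp_type:
  fixes q :: "complex poly"
  assumes n: "n > 0" and q: "degree q \<le> n" "\<And>w. norm w = 1 \<Longrightarrow> norm (poly q w) \<le> 1" and a: "norm a = 1"
  shows "norm (exp (- \<i> * t / 2) * poly q (a * exp (\<i> * t / of_nat n))) \<le> exp (\<bar>Im t\<bar> / 2)"
proof -
  define w where "w = a * exp (\<i> * t / of_nat n)"
  have w: "norm w = exp (- Im t / n)" using a by (simp add: w_def norm_mult)
  have "norm (poly q w) \<le> 1 * max 1 (norm w) ^ n"
    by (rule poly_norm_le_growth) (use q in auto)
  also have "\<dots> = (if Im t \<ge> 0 then 1 else exp (- Im t))"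
    using n by (simp add: w max_def divide_le_0_iff exp_of_nat_mult[symmetric])
  finally have "norm (poly q w) \<le> \<dots>" .
  then have "norm (exp (- \<i> * t / 2)) * norm (poly q w) \<le> exp (Im t / 2) * (if Im t \<ge> 0 then 1 else exp (- Im t))"
    by (intro mult_mono) auto
  also have "\<dots> = exp (\<bar>Im t\<bar> / 2)" by (simp add: mult_exp_exp)
  finally show ?thesis by (simp add: norm_mult w_def)
qed

text \<open>\<open>close\<close> keeps the difference of the angles below pi, so distinct parameters
  give distinct points and the separation of the points applies.\<close>

lemma cis_separated_parameters:
  fixes s t \<phi> n \<epsilon> :: real
  assumes n: "n > 0" and ne: "s \<noteq> t" and close: "\<bar>s - t\<bar> \<le> 2 * n"
    and sep: "cis (\<phi> + s / n) \<noteq> cis (\<phi> + t / n) \<Longrightarrow> norm (cis (\<phi> + s / n) - cis (\<phi> + t / n)) \<ge> \<epsilon> / n"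
  shows "\<epsilon> \<le> \<bar>s - t\<bar>"
proof -
  have "\<bar>(s - t) / n\<bar> \<le> 2" using close n by (simp add: field_simps)
  then have "\<bar>(s - t) / n\<bar> \<le> pi" using pi_ge_two by linarith
  then have "\<bar>(s - t) / n\<bar> \<le> 2 * norm (cis ((s - t) / n) - 1)" by (rule arc_le_chord)
  moreover have "\<bar>(s - t) / n\<bar> > 0" using ne n by simp
  ultimately have "cis ((s - t) / n) \<noteq> 1" by auto
  moreover have "cis (\<phi> + s / n) = cis (\<phi> + t / n) * cis ((s - t) / n)"
    by (simp add: cis_mult diff_divide_distrib)
  ultimately have "cis (\<phi> + s / n) \<noteq> cis (\<phi> + t / n)" by simp
  then have "\<epsilon> / n \<le> norm (cis (\<phi> + s / n) - cis (\<phi> + t / n))" by (rule sep)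
  also have "\<dots> \<le> \<bar>(\<phi> + s / n) - (\<phi> + t / n)\<bar>" by (rule norm_cis_diff_le)
  also have "(\<phi> + s / n) - (\<phi> + t / n) = (s - t) / n" by (simp add: diff_divide_distrib)
  finally show ?thesis using n by (simp add: abs_divide divide_le_cancel)
qed

text \<open>On the left stands the logarithmic contribution of \<open>2 * c * R\<close> zeros per
  ring, on the right Jensen's bound. The linear terms differ by a positive multiple of
  \<open>K\<close>, which beats \<open>ln K\<close>.\<close>

lemma eventually_dense_count_beats_type:
  fixes c R :: real
  assumes "c > 1 / (2 * pi)" "R > 0"
  shows "eventually (\<lambda>K::nat. 2 * c * R * (real K - 1 - ln K) > ln 4 + K * R * (c + 1 / (2 * pi))) sequentially"
proof -
  define d where "d = c - 1 / (2 * pi)"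
  have d: "d > 0" "c > 0" using assms by (auto simp: d_def intro: less_trans[of _ "1 / (2 * pi)"])
  have "filterlim (\<lambda>K::nat. d * R * real K - 2 * c * R * (1 + ln K) - ln 4) at_top sequentially"
    using d assms(2) by real_asymp
  then have "eventually (\<lambda>K::nat. d * R * real K - 2 * c * R * (1 + ln K) - ln 4 > 0) sequentially"
    unfolding filterlim_at_top_dense by (rule spec)
  then show ?thesis
    by (rule eventually_mono) (simp add: d_def algebra_simps)
qed

text \<open>Near a maximum point of \<open>q\<close>, rescaling turns \<open>q\<close> into an entire function of exponential
  type 1/2. If \<open>q\<close> were tiny on the sampling points, subtracting a small interpolating polynomial
  would produce a function with more zeros than Jensen's formula allows for this type.\<close>

lemma count_imp_lower_bound:
  assumes \<epsilon>: "\<epsilon> > 0"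
    and sep: "\<And>n j k. n \<ge> 1 \<Longrightarrow> j \<le> m n \<Longrightarrow> k \<le> m n \<Longrightarrow> j \<noteq> k \<Longrightarrow> norm (z n j - z n k) \<ge> \<epsilon> / real n"
    and c: "c > 1 / (2 * pi)" and R: "R > 0"
    and count: "\<And>n x. n \<ge> n1 \<Longrightarrow> c * R \<le> card (generation m z n \<inter> arc_between x (x + R / n))"
  obtains \<delta> n0 where "\<delta> > 0" "\<And>n q a. n \<ge> n0 \<Longrightarrow> degree q \<le> n \<Longrightarrow>
    (\<And>w. norm w = 1 \<Longrightarrow> norm (poly q w) \<le> 1) \<Longrightarrow> norm a = 1 \<Longrightarrow> norm (poly q a) = 1 \<Longrightarrow>
    \<exists>w\<in>generation m z n. norm (poly q w) > \<delta>"
proof -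
  have c0: "c > 0" using c by (rule less_trans[rotated]) simp
  obtain K :: nat where K: "K > 0" "2 * c * R * (real K - 1 - ln K) > ln 4 + K * R * (c + 1 / (2 * pi))"
    using eventually_conj[OF eventually_gt_at_top[of 0] eventually_dense_count_beats_type[OF c R]]
    by (auto simp: eventually_sequentially)
  define r where "r = K * R"
  have r: "r > 0" using K R by (simp add: r_def)
  define N where "N = nat \<lceil>c * R\<rceil>"
  have N: "c * R \<le> N" unfolding N_def by (rule real_nat_ceiling_ge)
  then have N0: "N > 0" using c0 R by (metis gr0I mult_pos_pos not_le of_nat_0)
  define D where "D = 2 * N * K"
  define B where "B = max 1 (2 * r / \<epsilon>) ^ D"
  have B: "B \<ge> 1" unfolding B_def by (intro one_le_power) simp
  have D: "D > 0" using K N0 by (simp add: D_def)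
  \<comment> \<open>Keeps the interpolating polynomial below 1/2 on the disc of radius
    \<open>r\<close>, so that at least half of the value at 0 survives the subtraction.\<close>
  define \<delta> where "\<delta> = 1 / (2 * D * B)"
  have \<delta>: "\<delta> > 0" using B D by (simp add: \<delta>_def)
  \<comment> \<open>Since \<open>n\<close> is at least \<open>r\<close>, two parameters differ by at
    most \<open>2 * n\<close>, as \<open>cis_separated_parameters\<close> requires.\<close>
  define n0 where "n0 = max n1 (max 1 (nat \<lceil>r\<rceil>))"
  show thesis
  proof (rule that[OF \<delta>, of n0], rule ccontr)
    fix n q a
    assume n_ge: "n \<ge> n0" and q: "degree q \<le> n" "\<And>w. norm w = 1 \<Longrightarrow> norm (poly q w) \<le> 1"
      and a: "norm a = 1" "norm (poly q a) = 1"
      and "\<not> (\<exists>w\<in>generation m z n. norm (poly q w) > \<delta>)"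
    then have small: "norm (poly q w) \<le> \<delta>" if "w \<in> generation m z n" for w
      using that by (auto simp: not_less)
    have n: "n \<ge> n1" "n \<ge> 1" "real n \<ge> r"
      using n_ge by (auto simp: n0_def nat_le_iff ceiling_le_iff)
    define \<phi> where "\<phi> = Arg a"
    have a_cis: "a = cis \<phi>" unfolding \<phi>_def using a(1) by (subst cis_Arg) (auto simp: sgn_div_norm)
    have fin: "finite (generation m z n)" by (simp add: generation_def)
    have np: "0 < real n" using n(2) by simp
    have N_le: "N \<le> card (generation m z n \<inter> arc_between x (x + R / n))" for x
      unfolding N_def using count[OF n(1), of x] by (simp add: nat_le_iff ceiling_le_iff)
    obtain Y :: "nat \<Rightarrow> real set" where Y: "\<And>j. finite (Y j)" "\<And>j. card (Y j) = 2 * N"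
      "\<And>j t. t \<in> Y j \<Longrightarrow> j * R < \<bar>t\<bar> \<and> \<bar>t\<bar> < Suc j * R \<and> cis (\<phi> + t / n) \<in> generation m z n"
      using symmetric_arc_parameters[OF fin np N_le R, of \<phi>] by blast
    define X where "X = (\<Union>j<K. Y j)"
    have X_fin: "finite X" using Y(1) by (simp add: X_def)
    have disj: "Y i \<inter> Y j = {}" if "i \<noteq> j" for i j
    proof -
      have "Y i \<inter> Y j = {}" if "i < j" for i j
      proof -
        have "real (Suc i) * R \<le> real j * R" using that R by (intro mult_right_mono) auto
        then show ?thesis using Y(3)[of _ i] Y(3)[of _ j] by fastforce
      qed
      from this[of i j] this[of j i] that show ?thesis by (cases i j rule: linorder_cases) auto
    qed
    have X_card: "card X = D"
      unfolding X_def using Y(1,2) disj by (subst card_UN_disjoint) (auto simp: D_def)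
    have X: "0 < \<bar>x\<bar>" "\<bar>x\<bar> < r" "cis (\<phi> + x / n) \<in> generation m z n" if x: "x \<in> X" for x
    proof -
      obtain j where j: "j < K" "x \<in> Y j" using x by (auto simp: X_def)
      have "0 \<le> j * R" "real (Suc j) * R \<le> r" unfolding r_def using R j by (auto intro!: mult_right_mono)
      then show "0 < \<bar>x\<bar>" "\<bar>x\<bar> < r" "cis (\<phi> + x / n) \<in> generation m z n"
        using Y(3)[OF j(2)] by linarith+
    qed
    define f where "f t = exp (- \<i> * t / 2) * poly q (a * exp (\<i> * t / of_nat n))" for t :: complex
    have f_type: "norm (f t) \<le> exp (\<bar>Im t\<bar> / 2)" for t
      unfolding f_def using n q a(1) by (intro norm_poly_exp_type) auto
    have f_real: "norm (f (of_real x)) = norm (poly q (cis (\<phi> + x / n)))" for x :: real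
      by (simp add: f_def norm_mult a_cis cis_conv_exp exp_add[symmetric] ring_distribs)
    have f0: "norm (f 0) = 1" using a by (simp add: f_def)
    define W where "W = complex_of_real ` X"
    have W_card: "card W = D" unfolding W_def X_card[symmetric] by (intro card_image inj_onI) auto
    have X_sep: "\<bar>x - y\<bar> \<ge> \<epsilon>" if xy: "x \<in> X" "y \<in> X" "x \<noteq> y" for x y
    proof (rule cis_separated_parameters[of "real n" x y \<phi> \<epsilon>])
      show "\<bar>x - y\<bar> \<le> 2 * real n" using X(2)[OF xy(1)] X(2)[OF xy(2)] n by linarith
      assume "cis (\<phi> + x / n) \<noteq> cis (\<phi> + y / n)"
      moreover obtain j k where "j \<le> m n" "k \<le> m n" "cis (\<phi> + x / n) = z n j" "cis (\<phi> + y / n) = z n k"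
        using X(3)[OF xy(1)] X(3)[OF xy(2)] by (auto simp: generation_def)
      ultimately show "norm (cis (\<phi> + x / n) - cis (\<phi> + y / n)) \<ge> \<epsilon> / n"
        using sep[OF n(2), of j k] by auto
    qed (use n xy in auto)
    obtain p where p: "\<And>x. x \<in> W \<Longrightarrow> poly p x = f x"
      "\<And>t. norm t \<le> r \<Longrightarrow> norm (poly p t) \<le> card W * (\<delta> * max 1 (2 * r / \<epsilon>) ^ card W)"
    proof (rule lagrange_interpolation_bound[of W \<epsilon> r f \<delta>])
      show "finite W" using X_fin by (simp add: W_def)
      show "\<epsilon> \<le> norm (x - y)" if "x \<in> W" "y \<in> W" "x \<noteq> y" for x y
        using that X_sep by (auto simp: W_def simp flip: of_real_diff)
      show "norm x \<le> r" if "x \<in> W" for x using that X(2) by (auto simp: W_def less_imp_le)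
      show "norm (f x) \<le> \<delta>" if x: "x \<in> W" for x
      proof -
        obtain y where "y \<in> X" "x = of_real y" using x by (auto simp: W_def)
        then show ?thesis using small[OF X(3)] f_real by metis
      qed
    qed (use \<epsilon> in auto)
    have p_half: "norm (poly p t) \<le> 1 / 2" if "norm t \<le> r" for t
      using p(2)[OF that] D B by (simp add: W_card \<delta>_def B_def[symmetric])
    define g where "g t = f t - poly p t" for t
    have g_hol: "g holomorphic_on UNIV" unfolding g_def f_def by (intro holomorphic_intros) auto
    have g0: "norm (g 0) \<ge> 1 / 2"
      using norm_triangle_ineq2[of "f 0" "poly p 0"] f0 p_half[of 0] r by (simp add: g_def)
    \<comment> \<open>With this \<open>e\<close> the exponent in Jensen's bound lies midway between
      r / pi, forced by the type, and 2 c r, forced by the zeros.\<close>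
    define e where "e = 2 * c - 1 / pi"
    have "1 / pi = 2 * (1 / (2 * pi))" by simp
    with c have e: "e > 0" unfolding e_def by linarith
    have "norm (g 0) * (\<Prod>x\<in>X. r / \<bar>x\<bar>) \<le> 2 * exp (1 / 2 * r * (2 / pi + e))"
    proof (rule jensen_exponential_type[OF g_hol X_fin])
      show "0 < \<bar>x\<bar> \<and> \<bar>x\<bar> < r" if "x \<in> X" for x using X that by simp
      show "g (of_real x) = 0" if "x \<in> X" for x using p(1) that by (simp add: g_def W_def)
      fix t :: complex assume t: "norm t = r"
      have "norm (g t) \<le> norm (f t) + norm (poly p t)" unfolding g_def by (rule norm_triangle_ineq4)
      also have "\<dots> \<le> exp (\<bar>Im t\<bar> / 2) + 1 / 2" using f_type[of t] p_half[of t] t by simp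
      also have "\<dots> \<le> 2 * exp (\<bar>Im t\<bar> / 2)"
      proof -
        have "1 \<le> exp (\<bar>Im t\<bar> / 2)" by simp
        then show ?thesis by linarith
      qed
      also have "\<bar>Im t\<bar> / 2 = 1 / 2 * \<bar>Im t\<bar>" by simp
      finally show "norm (g t) \<le> 2 * exp (1 / 2 * \<bar>Im t\<bar>)" .
    qed (use r e in auto)
    also have "1 / 2 * r * (2 / pi + e) = K * R * (c + 1 / (2 * pi))"
      by (simp add: e_def r_def field_simps)
    finally have upper: "norm (g 0) * (\<Prod>x\<in>X. r / \<bar>x\<bar>) \<le> 2 * exp (K * R * (c + 1 / (2 * pi)))" .
    define L where "L = real K - 1 - ln K"
    have L0: "L \<ge> 0" using ln_le_minus_one[of "real K"] K by (simp add: L_def)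
    have "exp (2 * c * R * L) \<le> exp (real (2 * N) * L)"
      using N L0 mult_right_mono[of "2 * c * R" "2 * N" L] by simp
    also have "\<dots> = exp L ^ (2 * N)" by (rule exp_of_nat_mult)
    also have "\<dots> \<le> (\<Prod>j<K. real K / real (Suc j)) ^ (2 * N)"
      unfolding L_def using prod_scaled_ge_exp[OF K(1)] by (intro power_mono) auto
    also have "\<dots> = (\<Prod>j<K. \<Prod>x\<in>Y j. real K / real (Suc j))"
      by (simp add: Y(2) prod_power_distrib)
    also have "\<dots> \<le> (\<Prod>j<K. \<Prod>x\<in>Y j. r / \<bar>x\<bar>)"
    proof (intro prod_mono conjI prod_nonneg)
      fix j x assume j: "j \<in> {..<K}" and x: "x \<in> Y j"
      have "x \<in> X" using j x by (auto simp: X_def)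
      then have "r / (Suc j * R) \<le> r / \<bar>x\<bar>" using Y(3)[OF x] X(1)[of x] r R by (intro divide_left_mono) auto
      then show "real K / real (Suc j) \<le> r / \<bar>x\<bar>" using R by (simp add: r_def)
    qed auto
    also have "\<dots> = (\<Prod>x\<in>X. r / \<bar>x\<bar>)"
      unfolding X_def using Y(1) disj by (subst prod.UNION_disjoint) auto
    finally have "1 / 2 * exp (2 * c * R * L) \<le> norm (g 0) * (\<Prod>x\<in>X. r / \<bar>x\<bar>)"
      using g0 by (intro mult_mono) auto
    also note upper
    finally have "exp (2 * c * R * L) \<le> 4 * exp (K * R * (c + 1 / (2 * pi)))" by simp
    also have "\<dots> = exp (ln 4 + K * R * (c + 1 / (2 * pi)))" by (simp add: exp_add)
    finally show False using K(2) by (simp add: L_def)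
  qed
qed

section \<open>Lower density\<close>

lemma arc_between_shift:
  "arc_between (x - 2 * pi * of_int k) (y - 2 * pi * of_int k) = arc_between x y"
proof -
  have cis: "cis (t - 2 * pi * of_int k) = cis t" for t
    by (simp add: cis_divide[symmetric] cis_multiple_2pi)
  have "{x - d<..<y - d} = (\<lambda>t. t - d) ` {x<..<y}" for d :: real
  proof (rule set_eqI)
    fix u
    have "u = (u + d) - d" by simp
    then show "u \<in> {x - d<..<y - d} \<longleftrightarrow> u \<in> (\<lambda>t. t - d) ` {x<..<y}"
      by (auto simp: image_iff intro!: bexI[of _ "u + d"])
  qed
  then have "arc_between (x - 2 * pi * of_int k) (y - 2 * pi * of_int k)
      = cis ` (\<lambda>t. t - 2 * pi * of_int k) ` {x<..<y}"
    unfolding arc_between_def by simp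
  also have "\<dots> = arc_between x y" by (simp only: image_image cis arc_between_def)
  finally show ?thesis .
qed

lemma finite_counts: "finite ((\<lambda>x. card (generation m z n \<inter> arc_between x (x + l))) ` A)"
proof (rule finite_subset)
  show "(\<lambda>x. card (generation m z n \<inter> arc_between x (x + l))) ` A \<subseteq> {..card (generation m z n)}"
    by (auto intro!: card_mono simp: generation_def)
qed simp

text \<open>Translation by a multiple of 2 pi brings any starting point into the range of the
  minimum.\<close>

lemma min_count_le:
  "Min ((\<lambda>x. card (generation m z n \<inter> arc_between x (x + l))) ` {0..2 * pi})
    \<le> card (generation m z n \<inter> arc_between x (x + l))"
proof -
  define k where "k = \<lfloor>x / (2 * pi)\<rfloor>"
  define y where "y = x - 2 * pi * of_int k"
  have "of_int k \<le> x / (2 * pi)" "x / (2 * pi) < of_int k + 1"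
    unfolding k_def by linarith+
  then have "y \<in> {0..2 * pi}" by (simp add: y_def field_simps)
  then have "Min ((\<lambda>x. card (generation m z n \<inter> arc_between x (x + l))) ` {0..2 * pi})
    \<le> card (generation m z n \<inter> arc_between y (y + l))"
    by (intro Min_le finite_counts imageI)
  also have "arc_between y (y + l) = arc_between x (x + l)"
    using arc_between_shift[of x k "x + l"] by (simp add: y_def algebra_simps)
  finally show ?thesis .
qed

text \<open>A single length \<open>R\<close> is extracted; longer windows are later tiled by arcs of
  this length. A \<open>c\<close> strictly between \<open>d\<close> and the density absorbs both
  lower limits.\<close>

lemma less_lower_density_imp_count:
  assumes "ereal d < lower_density m z"
  obtains c R n0 where "c > d" "R > 0"
    "\<And>n x. n \<ge> n0 \<Longrightarrow> c * R \<le> card (generation m z n \<inter> arc_between x (x + R / real n))"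
proof -
  obtain c where c: "ereal d < ereal c" "ereal c < lower_density m z"
    using ereal_dense2[OF assms] by blast
  from eventually_conj[OF less_LiminfD[OF c(2)[unfolded lower_density_def]] eventually_gt_at_top[of 0]]
  obtain R where R: "R > 0" "ereal c < Liminf sequentially (\<lambda>n.
       ereal (real (Min ((\<lambda>x. card (generation m z n \<inter> arc_between x (x + R / real n))) ` {0..2*pi})) / R))"
    by (auto dest!: eventually_happens)
  from less_LiminfD[OF R(2)] obtain n0 where n0: "\<And>n. n \<ge> n0 \<Longrightarrow> ereal c <
       ereal (real (Min ((\<lambda>x. card (generation m z n \<inter> arc_between x (x + R / real n))) ` {0..2*pi})) / R)"
    by (auto simp: eventually_sequentially)
  show thesis
  proof (rule that[of c R n0])
    fix n x assume "n \<ge> n0"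
    from n0[OF this] R(1)
    have "c * R \<le> real (Min ((\<lambda>x. card (generation m z n \<inter> arc_between x (x + R / real n))) ` {0..2*pi}))"
      by (simp add: field_simps)
    also have "\<dots> \<le> card (generation m z n \<inter> arc_between x (x + R / real n))"
      using min_count_le by (simp only: of_nat_le_iff)
    finally show "c * R \<le> card (generation m z n \<inter> arc_between x (x + R / real n))" .
  qed (use c R in auto)
qed

lemma count_imp_le_lower_density:
  assumes R1: "R1 > 0"
    and count: "\<And>R. R \<ge> R1 \<Longrightarrow> \<exists>n0. \<forall>n\<ge>n0. \<forall>x. c * R \<le> card (generation m z n \<inter> arc_between x (x + R / real n))"
  shows "ereal c \<le> lower_density m z"
  unfolding lower_density_def
proof (rule Liminf_bounded, rule eventually_at_top_linorderI[of R1], rule Liminf_bounded)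
  fix R assume R: "R \<ge> R1"
  from count[OF R] obtain n0 where n0: "\<And>n x. n \<ge> n0 \<Longrightarrow>
      c * R \<le> card (generation m z n \<inter> arc_between x (x + R / real n))" by blast
  show "\<forall>\<^sub>F n in sequentially. ereal c \<le>
     ereal (real (Min ((\<lambda>x. card (generation m z n \<inter> arc_between x (x + R / real n))) ` {0..2*pi})) / R)"
  proof (rule eventually_sequentiallyI[of n0])
    fix n assume n: "n \<ge> n0"
    have "Min ((\<lambda>x. card (generation m z n \<inter> arc_between x (x + R / real n))) ` {0..2*pi})
        \<in> (\<lambda>x. card (generation m z n \<inter> arc_between x (x + R / real n))) ` {0..2*pi}"
      by (intro Min_in finite_counts) auto
    then have "c * R \<le> real (Min ((\<lambda>x. card (generation m z n \<inter> arc_between x (x + R / real n))) ` {0..2*pi}))"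
      using n0[OF n] by auto
    then show "ereal c \<le>
      ereal (real (Min ((\<lambda>x. card (generation m z n \<inter> arc_between x (x + R / real n))) ` {0..2*pi})) / R)"
      using R R1 by (simp add: field_simps)
  qed
qed

section \<open>Sampling constants for single degrees and for all degrees\<close>

lemma sup_norm_attained:
  fixes q :: "complex poly"
  obtains a where "norm a = 1" "(SUP w\<in>sphere 0 1. norm (poly q w)) = norm (poly q a)"
    "\<And>w. norm w = 1 \<Longrightarrow> norm (poly q w) \<le> norm (poly q a)"
proof -
  have "\<exists>a\<in>sphere 0 1. \<forall>w\<in>sphere 0 1. norm (poly q w) \<le> norm (poly q a)"
    by (intro continuous_attains_sup continuous_intros) auto
  then obtain a where a: "norm a = 1" "\<And>w. norm w = 1 \<Longrightarrow> norm (poly q w) \<le> norm (poly q a)" by auto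
  have "(SUP w\<in>sphere 0 1. norm (poly q w)) = norm (poly q a)"
    using a by (intro cSup_eq_maximum) auto
  then show thesis using a by (intro that[of a]) auto
qed

text \<open>Separation makes the \<open>m n + 1\<close> points distinct, and these are more than the
  degree, so interpolation returns \<open>q\<close> itself. The constant depends on
  \<open>n\<close>.\<close>

lemma sampling_fixed_degree:
  assumes tri: "triangular_family m z" and \<epsilon>: "\<epsilon> > 0" and n: "n \<ge> 1"
    and sep: "\<And>j k. j \<le> m n \<Longrightarrow> k \<le> m n \<Longrightarrow> j \<noteq> k \<Longrightarrow> norm (z n j - z n k) \<ge> \<epsilon> / real n"
  obtains C where "C \<ge> 0" "\<And>(q :: complex poly) a B. degree q \<le> n \<Longrightarrow> norm a = 1 \<Longrightarrow>
    (\<And>j. j \<le> m n \<Longrightarrow> norm (poly q (z n j)) \<le> B) \<Longrightarrow> norm (poly q a) \<le> C * B"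
proof -
  define X where "X = generation m z n"
  have "\<epsilon> / real n > 0" using \<epsilon> n by simp
  have "inj_on (z n) {..m n}"
  proof (rule inj_onI, rule ccontr)
    fix j k assume "j \<in> {..m n}" "k \<in> {..m n}" "z n j = z n k" "j \<noteq> k"
    with sep[of j k] \<open>\<epsilon> / real n > 0\<close> show False by auto
  qed
  then have card: "card X = Suc (m n)" by (simp add: X_def generation_def card_image)
  have mn: "n \<le> m n" and circle: "\<And>x. x \<in> X \<Longrightarrow> norm x = 1"
    using tri by (auto simp: triangular_family_def X_def generation_def)
  define C where "C = card X * max 1 (2 * 1 / (\<epsilon> / n)) ^ card X"
  show thesis
  proof (rule that[of C])
    show "C \<ge> 0" by (simp add: C_def)
    fix q :: "complex poly" and a :: complex and B
    assume q: "degree q \<le> n" and a: "norm a = 1" and B: "\<And>j. j \<le> m n \<Longrightarrow> norm (poly q (z n j)) \<le> B"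
    obtain p where p: "degree p \<le> card X - 1" "\<And>x. x \<in> X \<Longrightarrow> poly p x = poly q x"
      "\<And>t. norm t \<le> 1 \<Longrightarrow> norm (poly p t) \<le> card X * (B * max 1 (2 * 1 / (\<epsilon> / n)) ^ card X)"
    proof (rule lagrange_interpolation_bound[of X "\<epsilon> / n" 1 "poly q" B])
      show "\<epsilon> / n \<le> norm (x - y)" if "x \<in> X" "y \<in> X" "x \<noteq> y" for x y
      proof -
        obtain j k where "j \<le> m n" "k \<le> m n" "x = z n j" "y = z n k"
          using \<open>x \<in> X\<close> \<open>y \<in> X\<close> by (auto simp: X_def generation_def)
        then show ?thesis using sep[of j k] \<open>x \<noteq> y\<close> by auto
      qed
    qed (use \<open>\<epsilon> / real n > 0\<close> circle B in \<open>auto simp: X_def generation_def\<close>)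
    have "p = q" by (rule poly_eqI_degree[of X]) (use p q card mn in auto)
    then show "norm (poly q a) \<le> C * B" using p(3)[of a] a by (simp add: C_def mult_ac)
  qed
qed

lemma lower_density_imp_MZ:
  assumes tri: "triangular_family m z" and "separated_family m z"
    and dens: "lower_density m z > ereal (1 / (2 * pi))"
  shows "MZ_family_Linf m z"
proof -
  obtain \<epsilon> where \<epsilon>: "\<epsilon> > 0"
    "\<And>n j k. n \<ge> 1 \<Longrightarrow> j \<le> m n \<Longrightarrow> k \<le> m n \<Longrightarrow> j \<noteq> k \<Longrightarrow> norm (z n j - z n k) \<ge> \<epsilon> / real n"
    using assms(2) unfolding separated_family_def by blast
  obtain c R n1 where c: "c > 1 / (2 * pi)" "R > 0"
    "\<And>n x. n \<ge> n1 \<Longrightarrow> c * R \<le> card (generation m z n \<inter> arc_between x (x + R / real n))"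
    using less_lower_density_imp_count[OF dens] by metis
  obtain \<delta> n0 where \<delta>: "\<delta> > 0" and large: "\<And>n q a. n \<ge> n0 \<Longrightarrow> degree q \<le> n \<Longrightarrow>
    (\<And>w. norm w = 1 \<Longrightarrow> norm (poly q w) \<le> 1) \<Longrightarrow> norm a = 1 \<Longrightarrow> norm (poly q a) = 1 \<Longrightarrow>
    \<exists>w\<in>generation m z n. norm (poly q w) > \<delta>"
    using count_imp_lower_bound[OF \<epsilon> c] by blast
  define P where "P n C \<longleftrightarrow> C \<ge> 0 \<and> (\<forall>(q :: complex poly) a B. degree q \<le> n \<longrightarrow> norm a = 1 \<longrightarrow>
      (\<forall>j\<le>m n. norm (poly q (z n j)) \<le> B) \<longrightarrow> norm (poly q a) \<le> C * B)" for n C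
  have "\<exists>C. P n C" if n1: "n \<ge> 1" for n
  proof -
    obtain C where C: "C \<ge> 0" "\<And>(q :: complex poly) a B. degree q \<le> n \<Longrightarrow> norm a = 1 \<Longrightarrow>
      (\<And>j. j \<le> m n \<Longrightarrow> norm (poly q (z n j)) \<le> B) \<Longrightarrow> norm (poly q a) \<le> C * B"
      using sampling_fixed_degree[OF tri \<epsilon>(1) n1 \<epsilon>(2)[OF n1]] by blast
    show ?thesis unfolding P_def using C(1) by (intro exI[of _ C] conjI allI impI C(2)) auto
  qed
  then have "\<forall>n\<in>{1..}. \<exists>C. P n C" by auto
  then obtain K where "\<forall>n\<in>{1..}. P n (K n)" using bchoice by blast
  then have K: "K n \<ge> 0" "degree q \<le> n \<Longrightarrow> norm a = 1 \<Longrightarrow>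
      (\<And>j. j \<le> m n \<Longrightarrow> norm (poly q (z n j)) \<le> B) \<Longrightarrow> norm (poly q a) \<le> K n * B"
    if "n \<ge> 1" for n a B and q :: "complex poly"
    using that unfolding P_def by auto
  \<comment> \<open>\<open>1 / \<delta>\<close> serves the degrees from \<open>n0\<close> on; the
    sum dominates each of the finitely many earlier constants.\<close>
  define C where "C = 1 / \<delta> + (\<Sum>n\<in>{1..<n0}. K n)"
  have sum0: "(\<Sum>n\<in>{1..<n0}. K n) \<ge> 0" using K(1) by (intro sum_nonneg) auto
  show ?thesis
    unfolding MZ_family_Linf_def
  proof (intro exI[of _ C] conjI allI impI)
    show "C > 0" using \<delta> sum0 by (simp add: C_def add_pos_nonneg)
    fix n :: nat and q :: "complex poly"
    assume n: "n \<ge> 1" and q: "degree q \<le> n"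
    define B where "B = (SUP j\<in>{..m n}. norm (poly q (z n j)))"
    have B: "norm (poly q (z n j)) \<le> B" if "j \<le> m n" for j
      unfolding B_def using that by (intro cSUP_upper bdd_above_finite) auto
    have B0: "B \<ge> 0" using B[of 0] norm_ge_zero order_trans by blast
    obtain a where a: "norm a = 1" "(SUP w\<in>sphere 0 1. norm (poly q w)) = norm (poly q a)"
      "\<And>w. norm w = 1 \<Longrightarrow> norm (poly q w) \<le> norm (poly q a)"
      using sup_norm_attained by metis
    have "norm (poly q a) \<le> C * B"
    proof (cases "n < n0")
      case True
      have "K n \<le> (\<Sum>n\<in>{1..<n0}. K n)" using True n K(1) by (intro member_le_sum) auto
      then have "K n \<le> C" using \<delta> by (simp add: C_def add_increasing)
      then show ?thesis using K(2)[OF n q a(1) B] B0 mult_right_mono[of "K n" C B] by linarith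
    next
      case False
      show ?thesis
      proof (cases "poly q a = 0")
        case True
        then show ?thesis using \<open>C > 0\<close> B0 by simp
      next
        case nz: False
        define s where "s = norm (poly q a)"
        have s: "s > 0" using nz by (simp add: s_def)
        define p where "p = smult (of_real (inverse s)) q"
        have p: "norm (poly p w) = norm (poly q w) / s" for w
          using s by (simp add: p_def norm_mult norm_inverse norm_divide divide_inverse)
        have "\<exists>w\<in>generation m z n. norm (poly p w) > \<delta>"
        proof (rule large[of n p a])
          show "degree p \<le> n" unfolding p_def using q by (rule order_trans[OF degree_smult_le])
          show "norm (poly p w) \<le> 1" if "norm w = 1" for w
            using a(3)[OF that] s unfolding p s_def[symmetric] by simp
          show "norm (poly p a) = 1" using s unfolding p s_def[symmetric] by simp
        qed (use False a in auto)
        then obtain j where "j \<le> m n" "\<delta> < norm (poly q (z n j)) / s"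
          by (auto simp: generation_def p)
        then have "\<delta> * s \<le> B" using B[of j] s by (simp add: field_simps)
        then have "s \<le> 1 / \<delta> * B" using \<delta> by (simp add: field_simps)
        also have "\<dots> \<le> C * B" using sum0 B0 by (intro mult_right_mono) (auto simp: C_def)
        finally show ?thesis by (simp add: s_def)
      qed
    qed
    then show "(SUP w\<in>sphere 0 1. norm (poly q w)) \<le> C * (SUP j\<in>{..m n}. norm (poly q (z n j)))"
      unfolding a(2) B_def .
  qed
qed

theorem theorem6:
  fixes m :: "nat \<Rightarrow> nat" and z :: "nat \<Rightarrow> nat \<Rightarrow> complex"
  assumes "triangular_family m z"
    and "separated_family m z"
  shows "MZ_family_Linf m z \<longleftrightarrow> lower_density m z > ereal (1 / (2 * pi))"
proof
  assume MZ: "MZ_family_Linf m z"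
  obtain c R1 where c: "c > 1 / (2 * pi)" "R1 > 0"
    "\<And>R. R \<ge> R1 \<Longrightarrow> \<exists>n0. \<forall>n\<ge>n0. \<forall>x. c * R \<le> card (generation m z n \<inter> arc_between x (x + R / n))"
    using MZ_imp_count[OF assms(1) MZ] by metis
  \<comment> \<open>As \<open>c\<close> does not depend on \<open>R\<close>, the strict inequality
    survives both lower limits.\<close>
  have "ereal (1 / (2 * pi)) < ereal c" using c(1) by simp
  also have "\<dots> \<le> lower_density m z" by (rule count_imp_le_lower_density[OF c(2,3)])
  finally show "lower_density m z > ereal (1 / (2 * pi))" .
next
  assume "lower_density m z > ereal (1 / (2 * pi))"
  then show "MZ_family_Linf m z" by (rule lower_density_imp_MZ[OF assms])
qed

end
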